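(* Let $G_o$ be a non-compact unimodular lcsc group and let $P_o\subset G_o$ be a subset such that the set $\Lambda:=P_oP_o^{-1}$ is relatively dense in $G_o$ and $\Lambda^3$ is uniformly discrete. Let $\mu$ be a $G_o$-invariant Borel probability measure on $\Omega_{P_o}^\times$ and let $\nu$ be its transverse measure on $\mathcal T_{P_o}$. Then for every integer $r\ge 1$ and for $\nu^{\otimes r}$-almost all $(Q_1,\dots,Q_r)\in\mathcal T_{P_o}^r$ there exists a sequence $(g_n)$ of elements of $Q_1\cap\dots\cap Q_r$ such that $$g_n.Q_1\to Q_1,\quad\dots,\quad g_n.Q_r\to Q_r\quad\text{and}\quad g_n\to\infty .$$
   Context: lcsc = locally compact second countable; $m_{G_o}$ is a Haar measure on $G_o$. $g_n\to\infty$ means that $(g_n)$ eventually leaves every compact set. $\mathcal C(G_o)$ is the space of closed subsets of $G_o$ with the Chabauty--Fell topology, i.e. the topology generated by the sets $\{P: P\cap K=\emptyset\}$ ($K\subset G_o$ compact) and $\{P: P\cap V\ne\emptyset\}$ ($V\subset G_o$ open); it is compact metrizable, and $G_o$ acts on it jointly continuously by $g.A:=Ag^{-1}$. $\Omega_{P_o}:=\overline{\{P_og^{-1}:g\in G_o\}}\subset \mathcal C(G_o)$ is the hull of $P_o$, $\Omega_{P_o}^\times:=\Omega_{P_o}\setminus\{\emptyset\}$, and $\mathcal T_{P_o}:=\{Q\in\Omega_{P_o}: e\in Q\}$. (Uniformly discrete sets are closed, so $P_o\in\mathcal C(G_o)$.) A subset $A\subset G_o$ is uniformly discrete if there is an identity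 neighbourhood $U$ with $AA^{-1}\cap U=\{e\}$; it is relatively dense if $G_o=KA$ for some compact $K\subset G_o$. $\Lambda^n$ denotes the $n$-fold product set. The transverse measure $\nu$ of $\mu$ is the unique finite Borel measure on $\mathcal T_{P_o}$ such that for every bounded non-negative Borel function $f$ on $G_o\times\mathcal T_{P_o}$, $$\int \sum_{p\in P} f(p^{-1},p.P)\,d\mu(P)=\int_{G_o}\int_{\mathcal T_{P_o}} f(g,Q)\,d\nu(Q)\,dm_{G_o}(g).$$ *)

theory Defs
  imports "HOL-Probability.Probability"
begin

text \<open>
  A topological group is a type of class \<^class>\<open>topological_group_add\<close>. This class does not
  assume commutativity, so the group law of the possibly non-abelian group \<open>G\<close> is written
  additively: \<open>g + h\<close>, \<open>- g\<close>, \<open>g - h = g + (- h)\<close> and \<open>0\<close> stand for the product \<open>g h\<close>, the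
  inverse of \<open>g\<close>, the product of \<open>g\<close> with the inverse of \<open>h\<close>, and the identity \<open>e\<close>. Likewise
  \<open>A + B\<close> is the product set of \<open>A\<close> and \<open>B\<close> (from \<^theory>\<open>HOL-Library.Set_Algebras\<close>).
  On sets \<open>A - B\<close> is the set-theoretic difference, whence the next definition.
\<close>

definition difference_set :: "'a::group_add set \<Rightarrow> 'a set \<Rightarrow> 'a set" where
  "difference_set A B = {a - b | a b. a \<in> A \<and> b \<in> B}"

definition uniformly_discrete :: "'a::topological_group_add set \<Rightarrow> bool" where
  "uniformly_discrete A \<longleftrightarrow> (\<exists>U. open U \<and> 0 \<in> U \<and> difference_set A A \<inter> U = {0})"

definition relatively_dense :: "'a::topological_group_add set \<Rightarrow> bool" where
  "relatively_dense A \<longleftrightarrow> (\<exists>K. compact K \<and> K + A = UNIV)"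

definition tends_to_infinity :: "(nat \<Rightarrow> 'a::topological_space) \<Rightarrow> bool" where
  "tends_to_infinity g \<longleftrightarrow> (\<forall>K. compact K \<longrightarrow> (\<forall>\<^sub>F n in sequentially. g n \<notin> K))"

text \<open>
  Regularity is not required below: it is automatic on a locally compact second countable space.
\<close>

definition haar_measure :: "'a::topological_group_add measure \<Rightarrow> bool" where
  "haar_measure m \<longleftrightarrow>
     sets m = sets borel \<and>
     (\<forall>K. compact K \<longrightarrow> emeasure m K < \<infinity>) \<and>
     emeasure m UNIV \<noteq> 0 \<and>
     (\<forall>g. distr m borel (\<lambda>x. g + x) = m)"

definition unimodular :: "'a::topological_group_add itself \<Rightarrow> bool" where
  "unimodular _ \<longleftrightarrow>
     (\<forall>m :: 'a measure. haar_measure m \<longrightarrow> (\<forall>g. distr m borel (\<lambda>x. x + g) = m))"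

definition borel_of :: "'a topology \<Rightarrow> 'a measure" where
  "borel_of X = sigma (topspace X) {U. openin X U}"

definition chabauty_fell :: "'a::topological_space set topology" where
  "chabauty_fell = topology_generated_by
     ({{P. closed P \<and> P \<inter> K = {}} | K. compact K} \<union>
      {{P. closed P \<and> P \<inter> V \<noteq> {}} | V. open V})"

lemma topspace_chabauty_fell:
  "topspace chabauty_fell = {P :: 'a::topological_space set. closed P}"
proof
  show "topspace chabauty_fell \<subseteq> {P. closed P}"
    unfolding chabauty_fell_def topology_generated_by_topspace by blast
  have "{P :: 'a set. closed P} = {P. closed P \<and> P \<inter> {} = {}}"
    by simp
  then have "{P :: 'a set. closed P} \<in> {{P. closed P \<and> P \<inter> K = {}} | K. compact K}"
    using compact_empty by blast
  then show "{P :: 'a set. closed P} \<subseteq> topspace chabauty_fell"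
    unfolding chabauty_fell_def topology_generated_by_topspace by (intro Union_upper UnI1)
qed

definition act :: "'a::group_add \<Rightarrow> 'a set \<Rightarrow> 'a set" where
  "act g A = (\<lambda>x. x - g) ` A"

definition orbit_hull :: "'a::topological_group_add set \<Rightarrow> 'a set set" where
  "orbit_hull P = chabauty_fell closure_of (range (\<lambda>g. act g P))"

definition punctured_hull :: "'a::topological_group_add set \<Rightarrow> 'a set set" where
  "punctured_hull P = orbit_hull P - {{}}"

definition transversal :: "'a::topological_group_add set \<Rightarrow> 'a set set" where
  "transversal P = {Q \<in> orbit_hull P. 0 \<in> Q}"

definition invariant_probability ::
  "'a::topological_group_add set \<Rightarrow> 'a set measure \<Rightarrow> bool" where
  "invariant_probability P \<mu> \<longleftrightarrow>
     prob_space \<mu> \<and>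
     sets \<mu> = sets (borel_of (subtopology chabauty_fell (punctured_hull P))) \<and>
     (\<forall>g. distr \<mu> \<mu> (act g) = \<mu>)"

text \<open>
  The sum over \<open>p \<in> R\<close> of non-negative terms is the integral against the counting measure on \<open>R\<close>.
\<close>

definition transverse_measure ::
  "'a::topological_group_add measure \<Rightarrow> 'a set \<Rightarrow> 'a set measure \<Rightarrow> 'a set measure \<Rightarrow> bool" where
  "transverse_measure m P \<mu> \<nu> \<longleftrightarrow>
     finite_measure \<nu> \<and>
     sets \<nu> = sets (borel_of (subtopology chabauty_fell (transversal P))) \<and>
     (\<forall>f :: 'a \<times> 'a set \<Rightarrow> real.
        f \<in> borel_measurable
          (borel_of (prod_topology euclidean (subtopology chabauty_fell (transversal P)))) \<longrightarrow>
        (\<forall>x \<in> UNIV \<times> transversal P. 0 \<le> f x) \<longrightarrow>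
        (\<exists>C. \<forall>x \<in> UNIV \<times> transversal P. f x \<le> C) \<longrightarrow>
        (\<integral>\<^sup>+ R. (\<integral>\<^sup>+ p. ennreal (f (- p, act p R)) \<partial>count_space R) \<partial>\<mu>) =
        (\<integral>\<^sup>+ g. (\<integral>\<^sup>+ Q. ennreal (f (g, Q)) \<partial>\<nu>) \<partial>m))"

end

theory Submission
  imports Defs
begin

text \<open>
  The transverse measure \<open>\<nu>\<close> is invariant under the partial maps \<open>Q \<mapsto> act g Q\<close>, \<open>g \<in> Q\<close>. It extends
  to an invariant measure on the union of the translates of the transversal by \<open>\<Lambda>\<close>, and this
  extension is finite: the elements \<open>g\<close> that carry a point \<open>R\<close> of the hull to this union form the
  set \<open>\<Lambda> + R\<close>, whose difference set lies in the uniformly discrete set \<open>\<Lambda> + \<Lambda> + \<Lambda>\<close>. Take the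
  \<open>r\<close>-fold product of the extension. If a set \<open>B\<close> of positive measure returned to itself only under
  finitely many diagonal translations, then its translates by \<open>\<Lambda>\<close> would have bounded overlap
  and equal measure; but \<open>\<Lambda>\<close> is infinite, because it is relatively dense in a non-compact group.
  Finally, as all points of the transversal are subsets of \<open>\<Lambda>\<close>, countably many sets \<open>B\<close>, given by
  prescribing \<open>Q\<^sub>i\<close> on finite parts of \<open>\<Lambda>\<close>, control convergence.
\<close>

section \<open>Uniformly discrete sets\<close>

lemma in_act_iff: "x \<in> act g A \<longleftrightarrow> x + g \<in> A"
  unfolding act_def by (auto simp: image_iff intro: bexI[of _ "x + g"])

lemma act_act: "act g (act h A) = act (g + h) A"
  by (auto simp: in_act_iff add.assoc)

lemma act_0: "act 0 A = A"
  by (auto simp: in_act_iff)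

lemma closed_act:
  fixes A :: "'a::topological_group_add set"
  assumes "closed A"
  shows "closed (act g A)"
proof -
  have "act g A = (\<lambda>x. x + g) -` A"
    by (auto simp: in_act_iff)
  then show ?thesis
    using assms by (auto intro!: closed_vimage continuous_intros)
qed

text \<open>This is continuity of subtraction at \<open>(x, y)\<close>, read off from a basic
  rectangle of the product topology.\<close>

lemma difference_nhds:
  fixes U :: "'a::topological_group_add set"
  assumes "open U" "x - y \<in> U"
  obtains V W where "open V" "open W" "x \<in> V" "y \<in> W" "\<And>a b. a \<in> V \<Longrightarrow> b \<in> W \<Longrightarrow> a - b \<in> U"
proof -
  have "continuous_on UNIV (\<lambda>p :: 'a \<times> 'a. fst p - snd p)"
    by (intro continuous_intros)
  then have "open ((\<lambda>p :: 'a \<times> 'a. fst p - snd p) -` U)"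
    using assms by (simp add: open_vimage)
  moreover have "(x, y) \<in> (\<lambda>p :: 'a \<times> 'a. fst p - snd p) -` U"
    using assms by simp
  ultimately obtain V W where "open V" "open W" "(x, y) \<in> V \<times> W"
      "V \<times> W \<subseteq> (\<lambda>p. fst p - snd p) -` U"
    by (rule open_prod_elim)
  then show ?thesis
    by (intro that[of V W]) auto
qed

text \<open>Points close enough to \<open>x\<close> have their difference in the isolating
  neighbourhood \<open>U\<close> of 0. The centre \<open>x\<close> is arbitrary, as the covering
  arguments below require.\<close>

lemma uniformly_discrete_separated:
  assumes "uniformly_discrete D"
  obtains W where "open W" "x \<in> W" "\<And>a b. a \<in> D \<inter> W \<Longrightarrow> b \<in> D \<inter> W \<Longrightarrow> a = b"
proof -
  obtain U where U: "open U" "0 \<in> U" "difference_set D D \<inter> U = {0}"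
    using assms unfolding uniformly_discrete_def by blast
  obtain V W where VW: "open V" "open W" "x \<in> V" "x \<in> W"
      "\<And>a b. a \<in> V \<Longrightarrow> b \<in> W \<Longrightarrow> a - b \<in> U"
    using difference_nhds[of U x x] U by auto
  show ?thesis
  proof (rule that[of "V \<inter> W"])
    fix a b assume "a \<in> D \<inter> (V \<inter> W)" "b \<in> D \<inter> (V \<inter> W)"
    then have "a - b \<in> difference_set D D \<inter> U"
      using VW unfolding difference_set_def by blast
    then show "a = b"
      using U by simp
  qed (use VW in auto)
qed

text \<open>Since \<open>uniformly_discrete\<close> asks for an intersection equal to
  \<open>{0}\<close>, the difference set of \<open>A\<close> must contain 0; this is where
  \<open>A \<noteq> {}\<close> enters.\<close>

lemma uniformly_discrete_subset:
  assumes "uniformly_discrete B" "A \<subseteq> B" "A \<noteq> {}"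
  shows "uniformly_discrete A"
proof -
  obtain U where U: "open U" "0 \<in> U" "difference_set B B \<inter> U = {0}"
    using assms(1) unfolding uniformly_discrete_def by blast
  obtain a where "a \<in> A"
    using assms by blast
  then have "0 \<in> difference_set A A"
    unfolding difference_set_def by force
  moreover have "difference_set A A \<subseteq> difference_set B B"
    using assms unfolding difference_set_def by blast
  ultimately have "difference_set A A \<inter> U = {0}"
    using U by blast
  then show ?thesis
    using U unfolding uniformly_discrete_def by blast
qed

text \<open>A small neighbourhood of \<open>x\<close> contains at most one point of
  \<open>D\<close>; if this is not \<open>x\<close>, it can be removed, finite sets being closed in
  a Hausdorff space.\<close>

lemma uniformly_discrete_isolated:
  fixes D :: "'a::{topological_group_add, t2_space} set"
  assumes "uniformly_discrete D"
  obtains W where "open W" "x \<in> W" "D \<inter> W \<subseteq> {x}"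
proof -
  obtain W where W: "open W" "x \<in> W" "\<And>a b. a \<in> D \<inter> W \<Longrightarrow> b \<in> D \<inter> W \<Longrightarrow> a = b"
    using uniformly_discrete_separated[OF assms] by blast
  have fin: "finite (D \<inter> W)"
  proof (cases "D \<inter> W = {}")
    case False
    then obtain a where "a \<in> D \<inter> W" by blast
    then have "D \<inter> W \<subseteq> {a}" using W(3) by blast
    then show ?thesis using finite_subset by blast
  qed simp
  then have "open (W - (D \<inter> W - {x}))"
    using W by (intro open_Diff finite_imp_closed) auto
  then show ?thesis
    using W by (intro that[of "W - (D \<inter> W - {x})"]) auto
qed

lemma uniformly_discrete_closed:
  fixes D :: "'a::{topological_group_add, t2_space} set"
  assumes "uniformly_discrete D"
  shows "closed D"
  unfolding closed_def
proof (subst open_subopen, intro ballI)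
  fix x assume "x \<in> - D"
  obtain W where "open W" "x \<in> W" "D \<inter> W \<subseteq> {x}"
    using uniformly_discrete_isolated[OF assms] by blast
  with \<open>x \<in> - D\<close> show "\<exists>T. open T \<and> x \<in> T \<and> T \<subseteq> - D"
    by blast
qed

lemma uniformly_discrete_neighbourhoods:
  fixes D :: "'a::{topological_group_add, t2_space} set"
  assumes "uniformly_discrete D"
  obtains W where "\<And>x. open (W x)" "\<And>x. x \<in> W x" "\<And>x. D \<inter> W x \<subseteq> {x}"
proof -
  have "\<forall>x. \<exists>W. open W \<and> x \<in> W \<and> D \<inter> W \<subseteq> {x}"
    by (intro allI) (rule uniformly_discrete_isolated[OF assms], blast)
  from choice[OF this] obtain W where "\<forall>x. open (W x) \<and> x \<in> W x \<and> D \<inter> W x \<subseteq> {x}"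
    by (rule exE)
  then show ?thesis
    by (intro that[of W]) simp_all
qed

text \<open>Cover \<open>K\<close> by neighbourhoods without points of \<open>D\<close> other than
  their centres: \<open>D \<inter> K\<close> then lies among the centres of a finite
  subcover.\<close>

lemma uniformly_discrete_finite_compact:
  fixes D :: "'a::{topological_group_add, t2_space} set"
  assumes "uniformly_discrete D" "compact K"
  shows "finite (D \<inter> K)"
proof -
  obtain W where W: "\<And>x. open (W x)" "\<And>x. x \<in> W x" "\<And>x. D \<inter> W x \<subseteq> {x}"
    by (rule uniformly_discrete_neighbourhoods[OF assms(1)], rule that)
  have "K \<subseteq> \<Union> (range W)"
  proof
    fix x show "x \<in> \<Union> (range W)"
      using W(2) by (rule UN_I[OF UNIV_I])
  qed
  then obtain C where C: "finite C" "K \<subseteq> \<Union> (W ` C)"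
    using compactE_image[OF assms(2), of UNIV W] W(1) by metis
  have "D \<inter> K \<subseteq> C"
  proof
    fix x assume "x \<in> D \<inter> K"
    then obtain y where "y \<in> C" "x \<in> W y"
      using C(2) by auto
    with W(3)[of y] \<open>x \<in> D \<inter> K\<close> show "x \<in> C"
      by auto
  qed
  then show ?thesis
    using C finite_subset by blast
qed

text \<open>The same covering argument, with Lindelof's theorem in place of compactness.\<close>

lemma uniformly_discrete_countable:
  fixes D :: "'a::{topological_group_add, t2_space, second_countable_topology} set"
  assumes "uniformly_discrete D"
  shows "countable D"
proof -
  obtain W where W: "\<And>x. open (W x)" "\<And>x. x \<in> W x" "\<And>x. D \<inter> W x \<subseteq> {x}"
    by (rule uniformly_discrete_neighbourhoods[OF assms(1)], rule that)
  obtain F where F: "F \<subseteq> range W" "countable F" "\<Union>F = \<Union>(range W)"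
    using Lindelof[of "range W"] W(1) by auto
  obtain C where C: "countable C" "F = W ` C"
    using F(1,2) by (metis countable_subset_image)
  have "D \<subseteq> C"
  proof
    fix x assume "x \<in> D"
    have "x \<in> \<Union>F"
      unfolding F(3) using W(2) by (rule UN_I[OF UNIV_I])
    then obtain y where "y \<in> C" "x \<in> W y"
      unfolding C(2) by (rule UN_E)
    with W(3)[of y] \<open>x \<in> D\<close> show "x \<in> C"
      by auto
  qed
  then show ?thesis
    using C(1) by (rule countable_subset)
qed

section \<open>The hull\<close>

lemma openin_chabauty_fell_hit:
  "open V \<Longrightarrow> openin chabauty_fell {P. closed P \<and> P \<inter> V \<noteq> {}}"
  unfolding chabauty_fell_def by (intro topology_generated_by_Basis) blast

lemma orbit_hull_closed: "R \<in> orbit_hull P \<Longrightarrow> closed R"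
  unfolding orbit_hull_def by (drule subsetD[OF closure_of_subset_topspace]) (simp add: topspace_chabauty_fell)

text \<open>Otherwise all differences between suitable neighbourhoods \<open>V\<close> of
  \<open>a\<close> and \<open>W\<close> of \<open>b\<close> avoid the closed difference set. Meeting
  both \<open>V\<close> and \<open>W\<close> is an open condition, hence shared by some
  \<open>act g P\<close>, whose differences are those of \<open>P\<close> because \<open>act\<close>
  translates on the right.\<close>

lemma orbit_hull_difference:
  fixes P :: "'a::topological_group_add set"
  assumes "R \<in> orbit_hull P" "closed (difference_set P P)" "a \<in> R" "b \<in> R"
  shows "a - b \<in> difference_set P P"
proof (rule ccontr)
  assume "a - b \<notin> difference_set P P"
  then obtain V W where VW: "open V" "open W" "a \<in> V" "b \<in> W"
      "\<And>x y. x \<in> V \<Longrightarrow> y \<in> W \<Longrightarrow> x - y \<in> - difference_set P P"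
    using difference_nhds[of "- difference_set P P" a b] assms(2) by auto
  let ?N = "{P. closed P \<and> P \<inter> V \<noteq> {}} \<inter> {P. closed P \<and> P \<inter> W \<noteq> {}}"
  have "openin chabauty_fell ?N"
    using VW by (intro openin_Int openin_chabauty_fell_hit)
  moreover have "R \<in> ?N"
    using VW(3,4) assms(3,4) orbit_hull_closed[OF assms(1)] by auto
  ultimately have "\<exists>Q \<in> range (\<lambda>g. act g P). Q \<in> ?N"
    using assms(1) unfolding orbit_hull_def in_closure_of by meson
  then obtain g where "act g P \<in> ?N"
    by auto
  then obtain x y where "x \<in> act g P" "x \<in> V" "y \<in> act g P" "y \<in> W"
    by auto
  moreover have "x - y = (x + g) - (y + g)"
    by (simp add: diff_conv_add_uminus minus_add add.assoc del: add_uminus_conv_diff)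
  ultimately show False
    using VW(5)[of x y] unfolding difference_set_def in_act_iff by auto
qed

section \<open>Borel sigma-algebras, and the sigma-algebra of the events
  \<open>x \<in> Q\<close>\<close>

lemma space_borel_of: "space (borel_of X) = topspace X"
  unfolding borel_of_def by (simp add: space_measure_of_conv)

lemma openin_borel_of: "openin X U \<Longrightarrow> U \<in> sets (borel_of X)"
  unfolding borel_of_def by (rule in_measure_of) (auto dest: openin_subset)

lemma measurable_continuous_map_borel_of:
  assumes "continuous_map X Y f"
  shows "f \<in> borel_of X \<rightarrow>\<^sub>M borel_of Y"
  unfolding borel_of_def[of Y]
proof (rule measurable_measure_of)
  show "{U. openin Y U} \<subseteq> Pow (topspace Y)"
    by (auto dest: openin_subset)
  show "f \<in> space (borel_of X) \<rightarrow> topspace Y"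
    using continuous_map_funspace[OF assms] by (simp add: space_borel_of)
  fix B assume "B \<in> {U. openin Y U}"
  then have "openin X {x \<in> topspace X. f x \<in> B}"
    using assms by (intro openin_continuous_map_preimage) simp_all
  moreover have "f -` B \<inter> space (borel_of X) = {x \<in> topspace X. f x \<in> B}"
    unfolding space_borel_of by blast
  ultimately show "f -` B \<inter> space (borel_of X) \<in> sets (borel_of X)"
    by (simp add: openin_borel_of)
qed

lemma borel_of_euclidean: "borel_of euclidean = borel"
  unfolding borel_of_def borel_def by simp

text \<open>A sigma-algebra on all sets, free of topology: every \<open>act g\<close> is measurable
  for it. It is coarse enough to be measurable on the transversal and fine enough to see finite
  patterns of points.\<close>

definition hit_algebra :: "'a set measure" where
  "hit_algebra = sigma UNIV (range (\<lambda>x. {Q. x \<in> Q}))"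

lemma space_hit_algebra [simp]: "space hit_algebra = UNIV"
  unfolding hit_algebra_def by (simp add: space_measure_of_conv)

lemma measurable_hit_algebra:
  fixes f :: "'b \<Rightarrow> 'a set"
  assumes "\<And>x. {w \<in> space M. x \<in> f w} \<in> sets M"
  shows "f \<in> M \<rightarrow>\<^sub>M hit_algebra"
  unfolding hit_algebra_def
proof (rule measurable_measure_of)
  fix B :: "'a set set" assume "B \<in> range (\<lambda>x. {Q. x \<in> Q})"
  then obtain x where "B = {Q. x \<in> Q}" by (rule rangeE)
  then have "f -` B \<inter> space M = {w \<in> space M. x \<in> f w}" by blast
  then show "f -` B \<inter> space M \<in> sets M" using assms by simp
qed auto

lemma sets_hit [measurable]: "{Q. x \<in> Q} \<in> sets hit_algebra"
  unfolding hit_algebra_def by (rule in_measure_of) auto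

lemma pred_hit [measurable (raw)]:
  assumes "f \<in> M \<rightarrow>\<^sub>M hit_algebra"
  shows "Measurable.pred M (\<lambda>w. x \<in> f w)"
  using pred_sets2[OF sets_hit assms, of x] by simp

lemma measurable_act [measurable (raw)]:
  fixes g :: "'a::group_add"
  assumes [measurable]: "f \<in> M \<rightarrow>\<^sub>M hit_algebra"
  shows "(\<lambda>w. act g (f w)) \<in> M \<rightarrow>\<^sub>M hit_algebra"
  by (rule measurable_hit_algebra) (simp add: in_act_iff)

section \<open>Invariance of the transverse measure\<close>

text \<open>Left translates of a null open set are null, and by Lindelof's theorem countably many of
  them cover the group, so the whole measure would vanish.\<close>

lemma emeasure_haar_open:
  fixes m :: "'a::{topological_group_add, second_countable_topology} measure"
  assumes "haar_measure m" "open U" "U \<noteq> {}"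
  shows "emeasure m U \<noteq> 0"
proof
  assume null: "emeasure m U = 0"
  have sets [simp]: "sets m = sets borel" and inv: "\<And>g. distr m borel (\<lambda>x. g + x) = m"
    and nz: "emeasure m UNIV \<noteq> 0"
    using assms unfolding haar_measure_def by auto
  have space [simp]: "space m = UNIV"
    using sets_eq_imp_space_eq[OF sets] by simp
  define W where "W g = (\<lambda>x. g + x) -` U" for g
  have openW: "open (W g)" for g
    unfolding W_def using assms(2) by (intro open_vimage continuous_intros) auto
  have nullW: "emeasure m (W g) = 0" for g
  proof -
    have "emeasure m (W g) = emeasure (distr m borel (\<lambda>x. g + x)) U"
      unfolding W_def using assms(2)
      by (subst emeasure_distr)
         (auto simp: measurable_cong_sets[OF sets refl] intro!: borel_measurable_continuous_onI continuous_intros)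
    then show ?thesis
      using inv null by simp
  qed
  obtain F where F: "F \<subseteq> range W" "countable F" "\<Union>F = \<Union>(range W)"
    using Lindelof[of "range W"] openW by auto
  obtain u where "u \<in> U"
    using assms(3) by auto
  then have "x \<in> W (u - x)" for x
    unfolding W_def by simp
  then have "\<Union>F = UNIV"
    unfolding F(3) by auto
  moreover have "\<Union>F \<in> null_sets m"
  proof -
    have "X \<in> null_sets m" if "X \<in> F" for X
    proof -
      have "X \<in> range W" using that F(1) by (rule rev_subsetD)
      then obtain g where "X = W g" by (rule rangeE)
      then show ?thesis
        using nullW openW by (auto intro!: null_setsI)
    qed
    then show ?thesis
      using null_sets_UN'[OF F(2), of "\<lambda>X. X" m] by simp
  qed
  ultimately show False
    using nz by auto
qed

section \<open>The setting; first properties of \<open>\<Lambda>\<close> and of the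
  transversal\<close>

locale transverse_system =
  fixes P \<Lambda> :: "'a::{topological_group_add, t2_space, second_countable_topology} set"
    and m :: "'a measure"
    and \<mu> \<nu> :: "'a set measure"
  assumes locally_compact: "locally_compact_space (euclidean :: 'a topology)"
    and noncompact: "\<not> compact (UNIV :: 'a set)"
    and unimodular: "unimodular TYPE('a)"
    and haar: "haar_measure m"
    and \<Lambda>_eq: "\<Lambda> = difference_set P P"
    and dense: "relatively_dense \<Lambda>"
    and discrete: "uniformly_discrete (\<Lambda> + \<Lambda> + \<Lambda>)"
    and invariant: "invariant_probability P \<mu>"
    and transverse: "transverse_measure m P \<mu> \<nu>"
begin

lemma P_nonempty: "P \<noteq> {}"
proof
  assume "P = {}"
  then have "\<Lambda> = {}"
    unfolding \<Lambda>_eq difference_set_def by simp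
  then have "K + \<Lambda> = {}" for K
    unfolding set_plus_def by simp
  then show False
    using dense unfolding relatively_dense_def by (metis UNIV_not_empty)
qed

lemma zero_in_\<Lambda>: "0 \<in> \<Lambda>"
proof -
  obtain p where "p \<in> P" using P_nonempty by auto
  then show ?thesis
    unfolding \<Lambda>_eq difference_set_def by force
qed

lemma uminus_in_\<Lambda>: "x \<in> \<Lambda> \<Longrightarrow> - x \<in> \<Lambda>"
  unfolding \<Lambda>_eq difference_set_def by clarsimp (metis minus_diff_eq)

lemma uniformly_discrete_\<Lambda>: "uniformly_discrete \<Lambda>"
proof (rule uniformly_discrete_subset[OF discrete])
  show "\<Lambda> \<subseteq> \<Lambda> + \<Lambda> + \<Lambda>"
  proof
    fix x assume "x \<in> \<Lambda>"
    then have "x + 0 + 0 \<in> \<Lambda> + \<Lambda> + \<Lambda>"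
      using zero_in_\<Lambda> by (intro set_plus_intro)
    then show "x \<in> \<Lambda> + \<Lambda> + \<Lambda>" by simp
  qed
qed (use zero_in_\<Lambda> in auto)

lemma countable_\<Lambda>: "countable \<Lambda>"
  by (rule uniformly_discrete_countable[OF uniformly_discrete_\<Lambda>])

text \<open>A finite \<open>\<Lambda>\<close> would exhibit the group as a finite union of right
  translates of a compact set.\<close>

lemma infinite_\<Lambda>: "infinite \<Lambda>"
proof
  assume fin: "finite \<Lambda>"
  obtain K where K: "compact K" "K + \<Lambda> = UNIV"
    using dense unfolding relatively_dense_def by auto
  have "compact ((\<lambda>x. x + l) ` K)" for l
    by (intro compact_continuous_image continuous_intros K)
  then have "compact (\<Union>l\<in>\<Lambda>. (\<lambda>x. x + l) ` K)"
    using fin by (intro compact_UN) auto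
  moreover have "(\<Union>l\<in>\<Lambda>. (\<lambda>x. x + l) ` K) = K + \<Lambda>"
    by (auto simp: set_plus_def)
  ultimately show False
    using noncompact K by simp
qed

lemma hull_difference: "R \<in> orbit_hull P \<Longrightarrow> a \<in> R \<Longrightarrow> b \<in> R \<Longrightarrow> a - b \<in> \<Lambda>"
  using orbit_hull_difference[of R P a b] uniformly_discrete_closed[OF uniformly_discrete_\<Lambda>]
  unfolding \<Lambda>_eq by simp

lemma transversal_closed: "Q \<in> transversal P \<Longrightarrow> closed Q"
  unfolding transversal_def using orbit_hull_closed by auto

lemma transversal_difference: "Q \<in> transversal P \<Longrightarrow> a \<in> Q \<Longrightarrow> b \<in> Q \<Longrightarrow> a - b \<in> \<Lambda>"
  using hull_difference[of Q a b] unfolding transversal_def by simp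

lemma transversal_zero: "Q \<in> transversal P \<Longrightarrow> 0 \<in> Q"
  unfolding transversal_def by simp

lemma transversal_subset: "Q \<in> transversal P \<Longrightarrow> a \<in> Q \<Longrightarrow> a \<in> \<Lambda>"
  using transversal_difference[of Q a 0] transversal_zero by simp

lemma topspace_transversal: "topspace (subtopology chabauty_fell (transversal P)) = transversal P"
  using transversal_closed by (auto simp: topspace_chabauty_fell)

lemma sets_\<nu>: "sets \<nu> = sets (borel_of (subtopology chabauty_fell (transversal P)))"
  using transverse unfolding transverse_measure_def by simp

lemma space_\<nu>: "space \<nu> = transversal P"
  using sets_eq_imp_space_eq[OF sets_\<nu>] by (simp only: space_borel_of topspace_transversal)

lemma finite_\<nu>: "finite_measure \<nu>"
  using transverse unfolding transverse_measure_def by simp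

text \<open>All points of \<open>Q\<close> lie in \<open>\<Lambda>\<close>, so containing
  \<open>x\<close> amounts to meeting a neighbourhood of \<open>x\<close> that has no other point of
  \<open>\<Lambda>\<close>.\<close>

lemma openin_transversal_hit:
  "openin (subtopology chabauty_fell (transversal P)) {Q \<in> transversal P. x \<in> Q}"
proof -
  obtain W where W: "open W" "x \<in> W" "\<Lambda> \<inter> W \<subseteq> {x}"
    using uniformly_discrete_isolated[OF uniformly_discrete_\<Lambda>] .
  have "{Q \<in> transversal P. x \<in> Q} = {Q. closed Q \<and> Q \<inter> W \<noteq> {}} \<inter> transversal P"
  proof (intro set_eqI iffI)
    fix Q assume Q: "Q \<in> {Q. closed Q \<and> Q \<inter> W \<noteq> {}} \<inter> transversal P"
    then obtain y where "y \<in> Q" "y \<in> W" by auto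
    moreover from this have "y \<in> \<Lambda>"
      using transversal_subset Q by auto
    ultimately have "x \<in> Q"
      using W(3) by auto
    then show "Q \<in> {Q \<in> transversal P. x \<in> Q}"
      using Q by simp
  qed (use transversal_closed W(2) in auto)
  then show ?thesis
    using openin_chabauty_fell_hit[OF W(1)] unfolding openin_subtopology by auto
qed

lemma measurable_\<nu>_hit [measurable]: "(\<lambda>Q. Q) \<in> \<nu> \<rightarrow>\<^sub>M hit_algebra"
  by (rule measurable_hit_algebra)
     (simp add: space_\<nu> sets_\<nu> openin_borel_of openin_transversal_hit)

lemma sets_haar [measurable_cong]: "sets m = sets borel"
  using haar unfolding haar_measure_def by simp

lemma translate_borel [measurable]: "(\<lambda>x :: 'a. x + g) \<in> borel \<rightarrow>\<^sub>M borel"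
  by (intro borel_measurable_continuous_onI continuous_intros)

text \<open>\<open>haar_measure\<close> speaks of left translations; for right translations
  unimodularity enters.\<close>

lemma emeasure_haar_translate:
  assumes [measurable]: "U \<in> sets borel"
  shows "emeasure m {x. x + g \<in> U} = emeasure m U"
proof -
  have "emeasure m U = emeasure (distr m borel (\<lambda>x. x + g)) U"
    using unimodular haar unfolding unimodular_def by simp
  also have "\<dots> = emeasure m {x. x + g \<in> U}"
    using sets_eq_imp_space_eq[OF sets_haar] by (subst emeasure_distr) (auto intro!: arg_cong[where f = "emeasure m"])
  finally show ?thesis ..
qed

text \<open>A compact neighbourhood makes the measure finite, openness makes it positive; both serve
  to cancel \<open>emeasure m U\<close> later.\<close>

lemma finite_neighbourhood:
  assumes "open V" "0 \<in> V"
  obtains U where "open U" "0 \<in> U" "U \<subseteq> V" "emeasure m U < \<infinity>" "emeasure m U \<noteq> 0"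
proof -
  have "\<exists>W K. open W \<and> compact (K :: 'a set) \<and> 0 \<in> W \<and> W \<subseteq> K"
    using bspec[OF locally_compact[unfolded locally_compact_space_def], of 0] by simp
  then obtain W K :: "'a set" where WK: "open W" "compact K" "0 \<in> W" "W \<subseteq> K"
    by metis
  have "emeasure m (W \<inter> V) \<le> emeasure m K"
    using WK sets_haar by (intro emeasure_mono) (auto intro: compact_imp_closed borel_closed)
  also have "\<dots> < \<infinity>"
    using haar WK unfolding haar_measure_def by auto
  finally have "emeasure m (W \<inter> V) < \<infinity>" .
  moreover have "emeasure m (W \<inter> V) \<noteq> 0"
    using WK assms by (intro emeasure_haar_open[OF haar]) auto
  ultimately show ?thesis
    using WK assms by (intro that[of "W \<inter> V"]) auto
qed

lemma transverse_rectangles: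
  assumes "finite J" and V: "\<And>k. k \<in> J \<Longrightarrow> V k \<in> sets borel"
    and C: "\<And>k. k \<in> J \<Longrightarrow> C k \<in> sets hit_algebra"
  shows "(\<integral>\<^sup>+ R. (\<integral>\<^sup>+ p. (\<Sum>k\<in>J. indicator (V k) (- p) * indicator (C k) (act p R))
            \<partial>count_space R) \<partial>\<mu>) =
         (\<Sum>k\<in>J. emeasure m (V k) * emeasure \<nu> {Q \<in> transversal P. Q \<in> C k})"
proof -
  let ?X = "borel_of (prod_topology euclidean (subtopology chabauty_fell (transversal P)))"
  define f where "f x = (\<Sum>k\<in>J. indicat_real (V k) (fst x) * indicat_real (C k) (snd x))" for x
  have fst_m: "fst \<in> ?X \<rightarrow>\<^sub>M borel"
    unfolding borel_of_euclidean[symmetric]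
    by (rule measurable_continuous_map_borel_of[OF continuous_map_fst])
  have "snd \<in> ?X \<rightarrow>\<^sub>M \<nu>"
    unfolding measurable_cong_sets[OF refl sets_\<nu>]
    by (rule measurable_continuous_map_borel_of[OF continuous_map_snd])
  from measurable_compose[OF this measurable_\<nu>_hit] have snd_m: "snd \<in> ?X \<rightarrow>\<^sub>M hit_algebra" .
  have "f \<in> borel_measurable ?X"
    unfolding f_def
    by (intro borel_measurable_sum borel_measurable_times
        measurable_compose[OF fst_m borel_measurable_indicator[OF V]]
        measurable_compose[OF snd_m borel_measurable_indicator[OF C]])
  moreover have "0 \<le> f x" for x
    unfolding f_def by (intro sum_nonneg) simp
  moreover have "f x \<le> card J" for x
    unfolding f_def by (rule order_trans[OF sum_bounded_above[where K = 1]]) (auto split: split_indicator)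
  ultimately have *: "(\<integral>\<^sup>+ R. (\<integral>\<^sup>+ p. ennreal (f (- p, act p R)) \<partial>count_space R) \<partial>\<mu>) =
      (\<integral>\<^sup>+ g. (\<integral>\<^sup>+ Q. ennreal (f (g, Q)) \<partial>\<nu>) \<partial>m)"
    using transverse unfolding transverse_measure_def by blast
  have f_eq: "ennreal (f x) = (\<Sum>k\<in>J. indicator (V k) (fst x) * indicator (C k) (snd x))" for x
    unfolding f_def by (subst sum_ennreal[symmetric]) (auto simp: ennreal_mult ennreal_indicator)
  have inner: "(\<integral>\<^sup>+ Q. (\<Sum>k\<in>J. indicator (V k) g * indicator (C k) Q) \<partial>\<nu>) =
      (\<Sum>k\<in>J. indicator (V k) g * emeasure \<nu> {Q \<in> transversal P. Q \<in> C k})" for g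
  proof (subst nn_integral_sum)
    fix k assume "k \<in> J"
    then show "(\<lambda>Q. indicator (V k) g * indicator (C k) Q :: ennreal) \<in> borel_measurable \<nu>"
      using measurable_compose[OF measurable_\<nu>_hit borel_measurable_indicator[OF C]]
      by (intro borel_measurable_times_ennreal) auto
  next
    have "(\<integral>\<^sup>+ Q. indicator (V k) g * indicator (C k) Q \<partial>\<nu>) =
        indicator (V k) g * emeasure \<nu> {Q \<in> transversal P. Q \<in> C k}" if "k \<in> J" for k
    proof -
      have [measurable]: "C k \<in> sets hit_algebra" using C that .
      have "(\<integral>\<^sup>+ Q. indicator (V k) g * indicator (C k) Q \<partial>\<nu>) =
          indicator (V k) g * (\<integral>\<^sup>+ Q. indicator (C k) Q \<partial>\<nu>)"
        by (rule nn_integral_cmult)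
           (rule measurable_compose[OF measurable_\<nu>_hit borel_measurable_indicator[OF C[OF that]]])
      also have "(\<integral>\<^sup>+ Q. indicator (C k) Q \<partial>\<nu>) =
          (\<integral>\<^sup>+ Q. indicator {Q \<in> space \<nu>. Q \<in> C k} Q \<partial>\<nu>)"
        by (intro nn_integral_cong) (simp split: split_indicator)
      also have "\<dots> = emeasure \<nu> {Q \<in> space \<nu>. Q \<in> C k}"
        by (rule nn_integral_indicator) measurable
      finally show ?thesis
        unfolding space_\<nu> .
    qed
    then show "(\<Sum>k\<in>J. \<integral>\<^sup>+ Q. indicator (V k) g * indicator (C k) Q \<partial>\<nu>) =
        (\<Sum>k\<in>J. indicator (V k) g * emeasure \<nu> {Q \<in> transversal P. Q \<in> C k})"
      by (rule sum.cong[OF refl])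
  qed
  have Vm: "V k \<in> sets m" if "k \<in> J" for k
    using V[OF that] sets_haar by simp
  have "(\<integral>\<^sup>+ g. (\<Sum>k\<in>J. indicator (V k) g * emeasure \<nu> {Q \<in> transversal P. Q \<in> C k}) \<partial>m) =
      (\<Sum>k\<in>J. \<integral>\<^sup>+ g. emeasure \<nu> {Q \<in> transversal P. Q \<in> C k} * indicator (V k) g \<partial>m)"
    using Vm by (subst nn_integral_sum) (auto intro!: sum.cong nn_integral_cong mult.commute)
  also have "\<dots> = (\<Sum>k\<in>J. emeasure m (V k) * emeasure \<nu> {Q \<in> transversal P. Q \<in> C k})"
    using Vm by (intro sum.cong refl) (subst nn_integral_cmult_indicator, auto intro: mult.commute)
  finally show ?thesis
    using * unfolding f_eq fst_conv snd_conv inner by simp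
qed

text \<open>Test the formula on \<open>V \<times> C1\<close> and on \<open>U \<times> C2\<close>.
  For each \<open>R\<close> the two sums agree by the substitution \<open>p \<mapsto> g + p\<close>,
  and the equal Haar measures of \<open>V\<close> and \<open>U\<close> cancel.\<close>

lemma transverse_invariant:
  assumes C [measurable]: "C \<in> sets hit_algebra"
  shows "emeasure \<nu> {Q \<in> transversal P. g \<in> Q \<and> act g Q \<in> C} =
         emeasure \<nu> {Q \<in> transversal P. Q \<in> C \<and> - g \<in> Q}"
proof -
  obtain U where U: "open U" "emeasure m U < \<infinity>" "emeasure m U \<noteq> 0"
    using finite_neighbourhood[OF open_UNIV UNIV_I] by metis
  \<comment> \<open>This right translate is chosen so that \<open>- p \<in> V\<close> iff
    \<open>- (g + p) \<in> U\<close>.\<close>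
  define V where "V = {h. h + (- g) \<in> U}"
  have [measurable]: "U \<in> sets borel"
    using U by simp
  have Vb: "V \<in> sets borel"
    unfolding V_def by measurable
  define C1 where "C1 = {Q. g \<in> Q \<and> act g Q \<in> C}"
  define C2 where "C2 = {Q. Q \<in> C \<and> - g \<in> Q}"
  have Cm: "C1 \<in> sets hit_algebra" "C2 \<in> sets hit_algebra"
  proof -
    have "{Q \<in> space hit_algebra. g \<in> Q \<and> act g Q \<in> C} \<in> sets hit_algebra"
      "{Q \<in> space hit_algebra. Q \<in> C \<and> - g \<in> Q} \<in> sets hit_algebra"
      by measurable
    then show "C1 \<in> sets hit_algebra" "C2 \<in> sets hit_algebra"
      unfolding C1_def C2_def by simp_all
  qed
  have "(\<integral>\<^sup>+ p. indicator V (- p) * indicator C1 (act p R) \<partial>count_space R) =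
      (\<integral>\<^sup>+ p. indicator U (- p) * indicator C2 (act p R) \<partial>count_space R)" for R
  proof -
    \<comment> \<open>The substitution need not preserve \<open>R\<close>, so the sums run over the
      group with membership in \<open>R\<close> as a factor. The conditions on \<open>g\<close> in
      \<open>C1\<close> and on \<open>- g\<close> in \<open>C2\<close> supply the missing
      membership: of \<open>g + p\<close> in the former, of \<open>p\<close> in the latter.\<close>
    have "bij_betw (\<lambda>p. g + p) UNIV UNIV"
      by (rule bij_betw_byWitness[where f' = "\<lambda>p. - g + p"]) (auto simp: add.assoc[symmetric])
    then have "(\<integral>\<^sup>+ p. indicator U (- (g + p)) * indicator C2 (act (g + p) R) * indicator R (g + p)
          \<partial>count_space UNIV) =
        (\<integral>\<^sup>+ p. indicator U (- p) * indicator C2 (act p R) * indicator R p \<partial>count_space UNIV)"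
      by (rule nn_integral_bij_count_space)
    moreover have "indicator V (- p) * indicator C1 (act p R) * indicator R p =
        (indicator U (- (g + p)) * indicator C2 (act (g + p) R) * indicator R (g + p) :: ennreal)" for p
    proof -
      have "- p \<in> V \<longleftrightarrow> - (g + p) \<in> U"
        unfolding V_def by (simp add: minus_add del: add_uminus_conv_diff)
      moreover have "- g \<in> act (g + p) R \<longleftrightarrow> p \<in> R"
        by (simp add: in_act_iff add.assoc[symmetric])
      moreover have "g \<in> act p R \<longleftrightarrow> g + p \<in> R"
        by (simp add: in_act_iff)
      ultimately show ?thesis
        unfolding C1_def C2_def by (auto simp: act_act split: split_indicator)
    qed
    ultimately show ?thesis
      by (simp add: nn_integral_count_space_indicator)
  qed
  then have "emeasure m V * emeasure \<nu> {Q \<in> transversal P. Q \<in> C1} =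
      emeasure m U * emeasure \<nu> {Q \<in> transversal P. Q \<in> C2}"
    using transverse_rectangles[of "{()}" "\<lambda>_. V" "\<lambda>_. C1"]
      transverse_rectangles[of "{()}" "\<lambda>_. U" "\<lambda>_. C2"] Vb Cm by simp
  moreover have "emeasure m V = emeasure m U"
    unfolding V_def by (rule emeasure_haar_translate) measurable
  ultimately have "emeasure \<nu> {Q \<in> transversal P. Q \<in> C1} = emeasure \<nu> {Q \<in> transversal P. Q \<in> C2}"
    using U by (auto simp: ennreal_mult_cancel_left)
  then show ?thesis
    unfolding C1_def C2_def by simp
qed

section \<open>Translates of the transversal by \<open>\<Lambda>\<close>\<close>

definition enum :: "nat \<Rightarrow> 'a" where
  "enum = from_nat_into \<Lambda>"

lemma bij_enum: "bij_betw enum UNIV \<Lambda>"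
  unfolding enum_def by (rule bij_betw_from_nat_into[OF countable_\<Lambda> infinite_\<Lambda>])

lemma enum_in_\<Lambda>: "enum k \<in> \<Lambda>"
  using bij_enum by (auto simp: bij_betw_def)

lemma enum_surj:
  assumes "x \<in> \<Lambda>"
  obtains k where "x = enum k"
proof -
  have "x \<in> range enum" using bij_enum assms by (simp add: bij_betw_def)
  then show ?thesis by (rule rangeE) (rule that)
qed

text \<open>\<open>- x \<in> Q\<close> says that \<open>act (- x) Q\<close> contains 0, so that
  \<open>Q\<close> is the translate by \<open>x\<close> of a set through 0. Taking the least index
  makes the classes disjoint.\<close>

definition first_hit :: "nat \<Rightarrow> 'a set set" where
  "first_hit k = {Q. - enum k \<in> Q \<and> (\<forall>j<k. - enum j \<notin> Q)}"

lemma sets_first_hit [measurable]: "first_hit k \<in> sets hit_algebra"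
proof -
  have "{Q \<in> space hit_algebra. - enum k \<in> Q \<and> (\<forall>j<k. - enum j \<notin> Q)} \<in> sets hit_algebra"
    by measurable
  then show ?thesis unfolding first_hit_def by simp
qed

lemma first_hit_unique: "Q \<in> first_hit j \<Longrightarrow> Q \<in> first_hit k \<Longrightarrow> j = k"
  unfolding first_hit_def by (metis (mono_tags, lifting) linorder_neqE_nat mem_Collect_eq)

lemma first_hit_exists:
  assumes "- x \<in> Q" "x \<in> \<Lambda>"
  obtains k where "Q \<in> first_hit k"
proof -
  obtain j where "x = enum j"
    using enum_surj[OF assms(2)] .
  then have "- enum j \<in> Q"
    using assms(1) by simp
  then have "- enum (LEAST k. - enum k \<in> Q) \<in> Q"
    by (rule LeastI)
  moreover have "- enum i \<notin> Q" if "i < (LEAST k. - enum k \<in> Q)" for i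
    using that by (rule not_less_Least)
  ultimately have "Q \<in> first_hit (LEAST k. - enum k \<in> Q)"
    unfolding first_hit_def by blast
  then show ?thesis
    by (rule that)
qed

text \<open>The piece of the transversal that \<open>lift\<close> moves by \<open>enum k\<close>:
  its translate is not reached with a smaller index.\<close>

definition level :: "nat \<Rightarrow> 'a set set" where
  "level k = {Q \<in> transversal P. act (enum k) Q \<in> first_hit k}"

text \<open>
  A pair \<open>(k, p)\<close> with \<open>p \<in> R\<close> and \<open>act p R \<in> level k\<close> is determined by \<open>enum k + p\<close>, and these
  points lie in \<open>\<Lambda> + R\<close>, whose difference set is contained in \<open>\<Lambda> + \<Lambda> + \<Lambda>\<close>.
\<close>

lemma sum_levels_bounded:
  obtains c where "c < \<infinity>" "\<And>n. (\<Sum>k<n. emeasure \<nu> (level k)) \<le> c"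
proof -
  obtain V where V: "open V" "0 \<in> V"
      "difference_set (\<Lambda> + \<Lambda> + \<Lambda>) (\<Lambda> + \<Lambda> + \<Lambda>) \<inter> V = {0}"
    using discrete unfolding uniformly_discrete_def by blast
  obtain V1 V2 where V12: "open V1" "open V2" "0 \<in> V1" "0 \<in> V2"
      "\<And>a b. a \<in> V1 \<Longrightarrow> b \<in> V2 \<Longrightarrow> a - b \<in> V"
    using difference_nhds[of V 0 0] V by auto
  \<comment> \<open>The formula for \<open>\<nu>\<close> involves \<open>- p\<close>, whereas
    differences \<open>h - h'\<close> of points \<open>h = enum k + p\<close> have to fall into
    \<open>V\<close>; hence the passage to negatives.\<close>
  have "open (uminus -` (V1 \<inter> V2))"
    using V12 by (intro open_vimage continuous_intros) auto
  moreover have "0 \<in> uminus -` (V1 \<inter> V2)"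
    using V12 by simp
  ultimately obtain U where U: "open U" "0 \<in> U" "U \<subseteq> uminus -` (V1 \<inter> V2)"
      "emeasure m U < \<infinity>" "emeasure m U \<noteq> 0"
    by (rule finite_neighbourhood)
  have [measurable]: "U \<in> sets borel"
    using U by simp
  \<comment> \<open>With this choice \<open>- p \<in> W k\<close> iff
    \<open>- (enum k + p) \<in> U\<close>, and all \<open>W k\<close> have the measure of
    \<open>U\<close>.\<close>
  define W where "W k = {h. h + (- enum k) \<in> U}" for k
  define C where "C k = {Q. act (enum k) Q \<in> first_hit k}" for k
  have Wb: "W k \<in> sets borel" for k
    unfolding W_def by measurable
  have Cm: "C k \<in> sets hit_algebra" for k
  proof -
    have "{Q \<in> space hit_algebra. act (enum k) Q \<in> first_hit k} \<in> sets hit_algebra"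
      by measurable
    then show ?thesis unfolding C_def by simp
  qed
  have mW: "emeasure m (W k) = emeasure m U" for k
    unfolding W_def by (rule emeasure_haar_translate) measurable
  have unique: "k = k' \<and> p = p'"
    if R: "R \<in> punctured_hull P" "p \<in> R" "p' \<in> R" and kp: "- p \<in> W k" "act p R \<in> C k"
      and kp': "- p' \<in> W k'" "act p' R \<in> C k'" for R k k' p p'
  proof -
    define h h' where "h = enum k + p" and "h' = enum k' + p'"
    have "- h \<in> U" "- h' \<in> U"
      using kp kp' unfolding W_def h_def h'_def by (simp_all add: minus_add del: add_uminus_conv_diff)
    then have "h \<in> V1" "h' \<in> V2"
      using U(3) by auto
    then have "h - h' \<in> V"
      using V12 by simp
    moreover have "p - p' \<in> \<Lambda>"
      using hull_difference R unfolding punctured_hull_def by auto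
    then have "enum k + (p - p') + (- enum k') \<in> \<Lambda> + \<Lambda> + \<Lambda>"
      by (intro set_plus_intro enum_in_\<Lambda> uminus_in_\<Lambda>)
    then have "h - h' \<in> \<Lambda> + \<Lambda> + \<Lambda>"
      unfolding h_def h'_def by (simp add: diff_conv_add_uminus minus_add add.assoc del: add_uminus_conv_diff)
    \<comment> \<open>As \<open>\<Lambda> + \<Lambda> + \<Lambda>\<close> contains 0, its elements
      are differences of its elements, so \<open>V\<close> meets it only in 0.\<close>
    moreover have "0 \<in> \<Lambda> + \<Lambda> + \<Lambda>"
      using set_plus_intro[OF set_plus_intro[OF zero_in_\<Lambda> zero_in_\<Lambda>] zero_in_\<Lambda>] by simp
    then have "h - h' - 0 \<in> difference_set (\<Lambda> + \<Lambda> + \<Lambda>) (\<Lambda> + \<Lambda> + \<Lambda>)"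
      using \<open>h - h' \<in> \<Lambda> + \<Lambda> + \<Lambda>\<close> unfolding difference_set_def by blast
    ultimately have "h - h' \<in> difference_set (\<Lambda> + \<Lambda> + \<Lambda>) (\<Lambda> + \<Lambda> + \<Lambda>) \<inter> V"
      by simp
    then have "h = h'"
      unfolding V(3) by simp
    moreover have "act h R \<in> first_hit k" "act h' R \<in> first_hit k'"
      using kp(2) kp'(2) unfolding C_def h_def h'_def by (simp_all add: act_act)
    ultimately have "k = k'"
      using first_hit_unique[of "act h R" k k'] by simp
    with \<open>h = h'\<close> show ?thesis
      unfolding h_def h'_def by simp
  qed
  \<comment> \<open>By \<open>unique\<close> at most one pair \<open>(k, p)\<close> contributes to
    the double sum, and it contributes 1.\<close>
  have inner: "(\<integral>\<^sup>+ p. (\<Sum>k<n. indicator (W k) (- p) * indicator (C k) (act p R)) \<partial>count_space R) \<le> 1"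
    if R: "R \<in> punctured_hull P" for R n
  proof (cases "\<exists>k p. p \<in> R \<and> - p \<in> W k \<and> act p R \<in> C k")
    case True
    then obtain k0 p0 where kp0: "p0 \<in> R" "- p0 \<in> W k0" "act p0 R \<in> C k0"
      by metis
    have "(\<Sum>k<n. indicator (W k) (- p) * indicator (C k) (act p R)) \<le> (indicator {p0} p :: ennreal)"
      if "p \<in> R" for p
    proof -
      have "indicator (W k) (- p) * indicator (C k) (act p R) \<le>
          (if k = k0 then indicator {p0} p else 0 :: ennreal)" for k
      proof (cases "- p \<in> W k \<and> act p R \<in> C k")
        case True
        then have "k = k0 \<and> p = p0"
          using unique[OF R that kp0(1) _ _ kp0(2,3)] by blast
        then show ?thesis
          using kp0 by simp
      qed auto
      then have "(\<Sum>k<n. indicator (W k) (- p) * indicator (C k) (act p R)) \<le>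
          (\<Sum>k<n. if k = k0 then indicator {p0} p else 0 :: ennreal)"
        by (rule sum_mono)
      also have "\<dots> \<le> indicator {p0} p"
        by simp
      finally show ?thesis .
    qed
    then have "(\<integral>\<^sup>+ p. (\<Sum>k<n. indicator (W k) (- p) * indicator (C k) (act p R)) \<partial>count_space R) \<le>
        (\<integral>\<^sup>+ p. indicator {p0} p \<partial>count_space R)"
      by (intro nn_integral_mono) simp
    also have "\<dots> = 1"
      using kp0 by simp
    finally show ?thesis .
  next
    case False
    then have "(\<integral>\<^sup>+ p. (\<Sum>k<n. indicator (W k) (- p) * indicator (C k) (act p R)) \<partial>count_space R) =
        (\<integral>\<^sup>+ p. 0 \<partial>count_space R)"
      by (intro nn_integral_cong sum.neutral) (auto split: split_indicator)
    then show ?thesis by simp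
  qed
  interpret prob_space \<mu>
    using invariant unfolding invariant_probability_def by simp
  have "space \<mu> \<subseteq> punctured_hull P"
  proof -
    have "space \<mu> = topspace (subtopology chabauty_fell (punctured_hull P))"
      unfolding space_borel_of[symmetric]
      by (rule sets_eq_imp_space_eq) (use invariant in \<open>simp add: invariant_probability_def\<close>)
    then show ?thesis by simp
  qed
  have "(\<integral>\<^sup>+ R. (\<integral>\<^sup>+ p. (\<Sum>k<n. indicator (W k) (- p) * indicator (C k) (act p R))
      \<partial>count_space R) \<partial>\<mu>) \<le> (\<integral>\<^sup>+ R. 1 \<partial>\<mu>)" for n
  proof (rule nn_integral_mono)
    fix R assume "R \<in> space \<mu>"
    then show "(\<integral>\<^sup>+ p. (\<Sum>k<n. indicator (W k) (- p) * indicator (C k) (act p R)) \<partial>count_space R) \<le> 1"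
      using \<open>space \<mu> \<subseteq> punctured_hull P\<close> by (intro inner) (rule subsetD)
  qed
  moreover have "(\<integral>\<^sup>+ R. (\<integral>\<^sup>+ p. (\<Sum>k<n. indicator (W k) (- p) * indicator (C k) (act p R))
      \<partial>count_space R) \<partial>\<mu>) = emeasure m U * (\<Sum>k<n. emeasure \<nu> (level k))" for n
    by (subst transverse_rectangles) (simp_all only: finite_lessThan Wb Cm[unfolded C_def] mW sum_distrib_left level_def C_def mem_Collect_eq)
  \<comment> \<open>The integrand is at most 1 and \<open>\<mu>\<close> is a probability measure;
    dividing by \<open>emeasure m U\<close> yields a bound independent of \<open>n\<close>.\<close>
  ultimately have "emeasure m U * (\<Sum>k<n. emeasure \<nu> (level k)) \<le> 1" for n
    by (simp add: emeasure_space_1)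
  then have "emeasure m U * (\<Sum>k<n. emeasure \<nu> (level k)) / emeasure m U \<le> 1 / emeasure m U" for n
    by (rule divide_right_mono_ennreal)
  then have "(\<Sum>k<n. emeasure \<nu> (level k)) \<le> 1 / emeasure m U" for n
    using U(4,5) by (simp add: mult.commute[of "emeasure m U"] mult_divide_eq_ennreal less_top[symmetric])
  moreover have "1 / emeasure m U < \<infinity>"
    using U(5) by (simp add: ennreal_divide_eq_top_iff less_top[symmetric])
  ultimately show ?thesis
    by (intro that)
qed

text \<open>
  \<open>lift\<close> extends \<open>\<nu>\<close> to the union of the translates of the transversal by \<open>\<Lambda>\<close>: on each translate
  it is the image of \<open>\<nu>\<close>, and it is assembled from disjoint pieces according to the first element
  of \<open>\<Lambda>\<close> that carries the transversal to the point in question.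
\<close>

definition lift :: "'a set measure" where
  "lift = distr (restrict_space (count_space UNIV \<Otimes>\<^sub>M \<nu>) {(k, Q). Q \<in> level k}) hit_algebra
     (\<lambda>(k, Q). act (enum k) Q)"

lemma sets_lift [measurable_cong, simp]: "sets lift = sets hit_algebra"
  unfolding lift_def by simp

lemma space_lift [simp]: "space lift = UNIV"
  unfolding lift_def by simp

text \<open>Slicing the product at \<open>k\<close> gives the summands; measurability in
  \<open>(k, Q)\<close> is checked for each \<open>k\<close> separately, the indices being
  countable.\<close>

lemma emeasure_lift:
  assumes [measurable]: "B \<in> sets hit_algebra"
  shows "emeasure lift B =
    (\<Sum>k. emeasure \<nu> {Q \<in> transversal P. act (enum k) Q \<in> B \<and> act (enum k) Q \<in> first_hit k})"
proof -
  interpret finite_measure \<nu> by (rule finite_\<nu>)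
  let ?N = "count_space (UNIV :: nat set) \<Otimes>\<^sub>M \<nu>"
  let ?L = "{(k, Q). Q \<in> level k}"
  let ?S = "\<lambda>k. {Q \<in> transversal P. act (enum k) Q \<in> B \<and> act (enum k) Q \<in> first_hit k}"
  have meas: "(\<lambda>(k, Q). act (enum k) Q) \<in> ?N \<rightarrow>\<^sub>M hit_algebra"
    by (rule measurable_pair_measure_countable1) (auto intro: measurable_act)
  have first: "Measurable.pred ?N (\<lambda>(k, Q). act (enum k) Q \<in> first_hit k)"
    by (rule measurable_pair_measure_countable1) simp_all
  have second: "Measurable.pred ?N (\<lambda>(k, Q). act (enum k) Q \<in> B)"
    by (rule measurable_pair_measure_countable1) simp_all
  have "?L = {x \<in> space ?N. case x of (k, Q) \<Rightarrow> act (enum k) Q \<in> first_hit k}"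
    by (auto simp: space_pair_measure space_\<nu> level_def)
  then have L: "?L \<in> sets ?N"
    using first by (simp add: pred_def)
  define X where "X = {(k, Q). Q \<in> ?S k}"
  have "X = {x \<in> space ?N. (case x of (k, Q) \<Rightarrow> act (enum k) Q \<in> B) \<and>
      (case x of (k, Q) \<Rightarrow> act (enum k) Q \<in> first_hit k)}"
    unfolding X_def by (auto simp: space_pair_measure space_\<nu>)
  then have X: "X \<in> sets ?N"
    using first second by simp
  have "emeasure lift B =
      emeasure (restrict_space ?N ?L) ((\<lambda>(k, Q). act (enum k) Q) -` B \<inter> space (restrict_space ?N ?L))"
    unfolding lift_def by (rule emeasure_distr) (use meas in \<open>auto intro: measurable_restrict_space1\<close>)
  also have "(\<lambda>(k, Q). act (enum k) Q) -` B \<inter> space (restrict_space ?N ?L) = X"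
    unfolding X_def by (auto simp: space_restrict_space space_pair_measure space_\<nu> level_def)
  also have "emeasure (restrict_space ?N ?L) X = emeasure ?N X"
    using L by (intro emeasure_restrict_space) (auto simp: X_def level_def)
  also have "\<dots> = (\<integral>\<^sup>+ k. emeasure \<nu> (Pair k -` X) \<partial>count_space UNIV)"
    by (rule emeasure_pair_measure_alt[OF X])
  also have "\<dots> = (\<Sum>k. emeasure \<nu> (?S k))"
    unfolding nn_integral_count_space_nat X_def by simp
  finally show ?thesis .
qed

lemma finite_lift: "finite_measure lift"
proof
  obtain c where c: "c < \<infinity>" "\<And>n. (\<Sum>k<n. emeasure \<nu> (level k)) \<le> c"
    by (rule sum_levels_bounded, rule that)
  have "emeasure lift (space lift) = (\<Sum>k. emeasure \<nu> (level k))"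
    using sets.top[of hit_algebra] by (subst emeasure_lift) (auto simp: level_def)
  also have "\<dots> \<le> c"
    using c by (intro suminf_le_const) auto
  finally show "emeasure lift (space lift) \<noteq> \<infinity>"
    using c by auto
qed

text \<open>The choice of first hits in \<open>lift\<close> is immaterial: split the image according
  to the class \<open>k\<close> of \<open>act x Q\<close>; by \<open>transverse_invariant\<close>
  each piece has the measure of the piece from which \<open>lift\<close> was assembled.\<close>

lemma distr_act_eq_density_lift:
  assumes "x \<in> \<Lambda>"
  shows "distr \<nu> hit_algebra (act x) = density lift (indicator {Q. - x \<in> Q})"
proof (rule measure_eqI)
  fix B assume "B \<in> sets (distr \<nu> hit_algebra (act x))"
  then have [measurable]: "B \<in> sets hit_algebra" by simp
  let ?S = "\<lambda>k. {Q \<in> transversal P. act x Q \<in> B \<and> act x Q \<in> first_hit k}"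
  have sets_S: "?S k \<in> sets \<nu>" for k
  proof -
    have "{Q \<in> space \<nu>. act x Q \<in> B \<and> act x Q \<in> first_hit k} \<in> sets \<nu>"
      by measurable
    then show ?thesis by (simp add: space_\<nu>)
  qed
  have "emeasure (distr \<nu> hit_algebra (act x)) B = emeasure \<nu> {Q \<in> transversal P. act x Q \<in> B}"
    by (subst emeasure_distr) (auto simp: space_\<nu> intro!: measurable_act arg_cong[where f = "emeasure \<nu>"])
  also have "{Q \<in> transversal P. act x Q \<in> B} = (\<Union>k. ?S k)"
  proof (intro equalityI subsetI)
    fix Q assume Q: "Q \<in> {Q \<in> transversal P. act x Q \<in> B}"
    then have "- x \<in> act x Q"
      using transversal_zero by (simp add: in_act_iff)
    then obtain k where "act x Q \<in> first_hit k"
      using assms by (rule first_hit_exists)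
    then show "Q \<in> (\<Union>k. ?S k)"
      using Q by auto
  qed auto
  also have "emeasure \<nu> (\<Union>k. ?S k) = (\<Sum>k. emeasure \<nu> (?S k))"
    using sets_S first_hit_unique
    by (intro suminf_emeasure[symmetric]) (auto simp: disjoint_family_on_def)
  also have "\<dots> = (\<Sum>k. emeasure \<nu> {Q \<in> transversal P.
      act (enum k) Q \<in> B \<inter> {Q. - x \<in> Q} \<and> act (enum k) Q \<in> first_hit k})"
  proof (rule suminf_cong)
    fix k
    \<comment> \<open>As \<open>enum k + g = x\<close>, the translate of \<open>act g Q\<close> by
      \<open>enum k\<close> is \<open>act x Q\<close>, and \<open>g \<in> Q\<close> says that
      \<open>- enum k \<in> act x Q\<close>.\<close>
    define g where "g = - enum k + x"
    define C where "C = {Q. act (enum k) Q \<in> B \<and> act (enum k) Q \<in> first_hit k}"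
    have "{Q \<in> space hit_algebra. act (enum k) Q \<in> B \<and> act (enum k) Q \<in> first_hit k} \<in> sets hit_algebra"
      by measurable
    then have "C \<in> sets hit_algebra"
      unfolding C_def by simp
    from transverse_invariant[OF this, of g]
    have "emeasure \<nu> {Q \<in> transversal P. g \<in> Q \<and> act g Q \<in> C} =
        emeasure \<nu> {Q \<in> transversal P. Q \<in> C \<and> - g \<in> Q}" .
    moreover have "{Q \<in> transversal P. g \<in> Q \<and> act g Q \<in> C} = ?S k"
      unfolding C_def g_def by (auto simp: act_act add.assoc[symmetric] first_hit_def in_act_iff)
    moreover have "{Q \<in> transversal P. Q \<in> C \<and> - g \<in> Q} = {Q \<in> transversal P.
        act (enum k) Q \<in> B \<inter> {Q. - x \<in> Q} \<and> act (enum k) Q \<in> first_hit k}"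
      unfolding C_def g_def by (auto simp: in_act_iff minus_add simp del: add_uminus_conv_diff)
    ultimately show "emeasure \<nu> (?S k) = emeasure \<nu> {Q \<in> transversal P.
        act (enum k) Q \<in> B \<inter> {Q. - x \<in> Q} \<and> act (enum k) Q \<in> first_hit k}"
      by simp
  qed
  also have "\<dots> = emeasure lift (B \<inter> {Q. - x \<in> Q})"
    by (rule emeasure_lift[symmetric]) measurable
  also have "\<dots> = emeasure (density lift (indicator {Q. - x \<in> Q})) B"
    using borel_measurable_indicator[of "{Q. - x \<in> Q}" lift]
    by (subst emeasure_density)
       (auto simp: nn_integral_indicator[symmetric] indicator_inter_arith mult.commute
         simp del: nn_integral_indicator intro!: nn_integral_cong)
  finally show "emeasure (distr \<nu> hit_algebra (act x)) B =
      emeasure (density lift (indicator {Q. - x \<in> Q})) B" .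
qed simp

section \<open>Recurrence on products\<close>

text \<open>The diagonal action on tuples, kept extensional as the product space demands.\<close>

definition act_all :: "'i set \<Rightarrow> 'a \<Rightarrow> ('i \<Rightarrow> 'a set) \<Rightarrow> 'i \<Rightarrow> 'a set" where
  "act_all I g \<omega> = (\<lambda>i\<in>I. act g (\<omega> i))"

lemma act_all_apply: "i \<in> I \<Longrightarrow> act_all I g \<omega> i = act g (\<omega> i)"
  unfolding act_all_def by simp

lemma act_all_act_all: "act_all I g (act_all I h \<omega>) = act_all I (g + h) \<omega>"
  unfolding act_all_def by (rule ext) (simp add: act_act restrict_def)

lemma act_all_0: "\<omega> \<in> extensional I \<Longrightarrow> act_all I 0 \<omega> = \<omega>"
  unfolding act_all_def by (auto simp: act_0 extensional_restrict)

lemma measurable_component_hit: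
  assumes "\<And>i. i \<in> I \<Longrightarrow> (\<lambda>Q. Q) \<in> M i \<rightarrow>\<^sub>M hit_algebra" "i \<in> I"
  shows "(\<lambda>\<omega>. \<omega> i) \<in> Pi\<^sub>M I M \<rightarrow>\<^sub>M hit_algebra"
  by (rule measurable_compose[OF measurable_component_singleton[OF assms(2)], where g = "\<lambda>Q. Q"])
     (rule assms(1)[OF assms(2)])

lemma measurable_act_all:
  assumes "\<And>i. i \<in> I \<Longrightarrow> (\<lambda>Q. Q) \<in> M i \<rightarrow>\<^sub>M hit_algebra"
  shows "act_all I g \<in> Pi\<^sub>M I M \<rightarrow>\<^sub>M Pi\<^sub>M I (\<lambda>_. hit_algebra)"
  unfolding act_all_def
  by (intro measurable_restrict measurable_act measurable_component_hit assms)

lemma hit_algebra_ident: "(\<lambda>Q. Q) \<in> hit_algebra \<rightarrow>\<^sub>M hit_algebra"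
  by (rule measurable_ident_sets) simp

lemma lift_ident: "(\<lambda>Q. Q) \<in> lift \<rightarrow>\<^sub>M hit_algebra"
  by (rule measurable_ident_sets) simp

lemma sets_all_hit:
  assumes "finite I" "\<And>i. i \<in> I \<Longrightarrow> (\<lambda>Q. Q) \<in> M i \<rightarrow>\<^sub>M hit_algebra"
  shows "{\<omega> \<in> space (Pi\<^sub>M I M). \<forall>i\<in>I. x \<in> \<omega> i} \<in> sets (Pi\<^sub>M I M)"
proof -
  have "Measurable.pred (Pi\<^sub>M I M) (\<lambda>\<omega>. \<forall>i\<in>I. x \<in> \<omega> i)"
    by (intro pred_intros_finite assms(1) pred_hit measurable_component_hit assms(2))
  then show ?thesis by (simp add: pred_def)
qed

text \<open>Both sides have the values of the product of the measures
  \<open>distr \<nu> hit_algebra (act x)\<close> on boxes: the action is coordinatewise, and the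
  indicator factors over the coordinates, where \<open>distr_act_eq_density_lift\<close>
  applies.\<close>

lemma distr_act_all_eq_density:
  assumes I: "finite I" and x: "x \<in> \<Lambda>"
  shows "distr (\<Pi>\<^sub>M i\<in>I. \<nu>) (\<Pi>\<^sub>M i\<in>I. hit_algebra) (act_all I x) =
    density (\<Pi>\<^sub>M i\<in>I. lift) (indicator {\<omega> \<in> space (\<Pi>\<^sub>M i\<in>I. lift). \<forall>i\<in>I. - x \<in> \<omega> i})"
    (is "?distr = density ?L (indicator ?S)")
proof -
  let ?D = "distr \<nu> hit_algebra (act x)"
  let ?N = "\<Pi>\<^sub>M i\<in>I. \<nu>"
  have act_x: "act x \<in> \<nu> \<rightarrow>\<^sub>M hit_algebra"
    using measurable_act[OF measurable_\<nu>_hit] .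
  interpret \<nu>: finite_measure \<nu> by (rule finite_\<nu>)
  interpret lift: finite_measure lift by (rule finite_lift)
  interpret D: finite_measure ?D by (rule \<nu>.finite_measure_distr[OF act_x])
  interpret N: product_sigma_finite "\<lambda>_. \<nu>" by unfold_locales
  interpret L: product_sigma_finite "\<lambda>_. lift" by unfold_locales
  interpret D: product_sigma_finite "\<lambda>_. ?D" by unfold_locales
  have S: "?S \<in> sets ?L"
    using I lift_ident by (rule sets_all_hit)
  have "?distr = (\<Pi>\<^sub>M i\<in>I. ?D)"
  proof (rule D.PiM_eqI[OF I])
    show "sets ?distr = sets (\<Pi>\<^sub>M i\<in>I. ?D)"
      unfolding sets_distr by (rule sets_PiM_cong) simp_all
    fix A assume "\<And>i. i \<in> I \<Longrightarrow> A i \<in> sets ?D"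
    then have A: "A i \<in> sets hit_algebra" if "i \<in> I" for i
      using that by simp
    have meas: "{Q \<in> space \<nu>. act x Q \<in> A i} \<in> sets \<nu>" if "i \<in> I" for i
      using measurable_sets_Collect[OF act_x, of "\<lambda>Q. Q \<in> A i"] A[OF that] by simp
    have "emeasure ?distr (Pi\<^sub>E I A) = emeasure ?N (act_all I x -` Pi\<^sub>E I A \<inter> space ?N)"
      using A I by (intro emeasure_distr measurable_act_all measurable_\<nu>_hit sets_PiM_I_finite)
    also have "act_all I x -` Pi\<^sub>E I A \<inter> space ?N = (\<Pi>\<^sub>E i\<in>I. {Q \<in> space \<nu>. act x Q \<in> A i})"
      by (auto simp: space_PiM PiE_iff act_all_def)
    also have "emeasure ?N \<dots> = (\<Prod>i\<in>I. emeasure \<nu> {Q \<in> space \<nu>. act x Q \<in> A i})"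
      using I meas by (rule N.emeasure_PiM)
    also have "\<dots> = (\<Prod>i\<in>I. emeasure ?D (A i))"
      using A act_x by (intro prod.cong refl) (subst emeasure_distr, auto intro!: arg_cong[where f = "emeasure \<nu>"])
    finally show "emeasure ?distr (Pi\<^sub>E I A) = (\<Prod>i\<in>I. emeasure ?D (A i))" .
  qed
  moreover have "density ?L (indicator ?S) = (\<Pi>\<^sub>M i\<in>I. ?D)"
  proof (rule D.PiM_eqI[OF I])
    show "sets (density ?L (indicator ?S)) = sets (\<Pi>\<^sub>M i\<in>I. ?D)"
      unfolding sets_density by (rule sets_PiM_cong) simp_all
    fix A assume "\<And>i. i \<in> I \<Longrightarrow> A i \<in> sets ?D"
    then have A: "A i \<in> sets hit_algebra" if "i \<in> I" for i
      using that by simp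
    then have B: "{Q. - x \<in> Q} \<inter> A i \<in> sets lift" if "i \<in> I" for i
      using that by simp
    have "emeasure (density ?L (indicator ?S)) (Pi\<^sub>E I A) = emeasure ?L (?S \<inter> Pi\<^sub>E I A)"
      using S A I by (intro emeasure_restricted sets_PiM_I_finite) simp_all
    also have "?S \<inter> Pi\<^sub>E I A = (\<Pi>\<^sub>E i\<in>I. {Q. - x \<in> Q} \<inter> A i)"
      by (auto simp: space_PiM PiE_iff)
    also have "emeasure ?L \<dots> = (\<Prod>i\<in>I. emeasure lift ({Q. - x \<in> Q} \<inter> A i))"
      using I B by (rule L.emeasure_PiM)
    also have "\<dots> = (\<Prod>i\<in>I. emeasure ?D (A i))"
      unfolding distr_act_eq_density_lift[OF x]
      using A by (intro prod.cong refl emeasure_restricted[symmetric]) simp_all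
    finally show "emeasure (density ?L (indicator ?S)) (Pi\<^sub>E I A) = (\<Prod>i\<in>I. emeasure ?D (A i))" .
  qed
  ultimately show ?thesis by simp
qed

text \<open>
  If the points of a set \<open>B\<close> return to \<open>B\<close> only under elements of the finite set \<open>F\<close>, then the
  translates of \<open>B\<close> by \<open>\<Lambda>\<close> overlap at most \<open>card F\<close> times. Since they all have the measure of
  \<open>B\<close> and lie in a space of finite measure, \<open>B\<close> is a null set.
\<close>

lemma AE_return:
  assumes I: "finite I" and F: "finite F" and A: "A \<in> sets (\<Pi>\<^sub>M i\<in>I. hit_algebra)"
    and zero: "\<And>\<omega> i. \<omega> \<in> A \<Longrightarrow> i \<in> I \<Longrightarrow> 0 \<in> \<omega> i"
  shows "AE \<omega> in (\<Pi>\<^sub>M i\<in>I. \<nu>). \<omega> \<in> A \<longrightarrow>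
    (\<exists>g. g \<notin> F \<and> (\<forall>i\<in>I. g \<in> \<omega> i) \<and> act_all I g \<omega> \<in> A)"
proof -
  let ?H = "\<Pi>\<^sub>M i\<in>I. hit_algebra :: 'a set measure"
  let ?N = "\<Pi>\<^sub>M i\<in>I. \<nu>"
  let ?L = "\<Pi>\<^sub>M i\<in>I. lift"
  \<comment> \<open>Overlaps of translates by \<open>\<Lambda>\<close> produce only such elements.
    Testing returns against this countable set keeps \<open>B\<close> measurable and can only
    enlarge the exceptional set.\<close>
  define \<Gamma> where "\<Gamma> = (\<lambda>(a, b). - a + b) ` (\<Lambda> \<times> \<Lambda>)"
  have countable_\<Gamma>: "countable (\<Gamma> - F)"
    unfolding \<Gamma>_def using countable_\<Lambda> by (intro countable_Diff countable_image countable_SIGMA)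
  define B where "B = {\<omega> \<in> space ?H. \<omega> \<in> A \<and>
      (\<forall>g\<in>\<Gamma> - F. \<not> ((\<forall>i\<in>I. g \<in> \<omega> i) \<and> act_all I g \<omega> \<in> A))}"
  have pred_A: "Measurable.pred M (\<lambda>\<omega>. f \<omega> \<in> A)" if "f \<in> M \<rightarrow>\<^sub>M ?H" for M f
    using pred_sets2[OF A that] .
  have "Measurable.pred ?H (\<lambda>\<omega>. \<not> ((\<forall>i\<in>I. g \<in> \<omega> i) \<and> act_all I g \<omega> \<in> A))" for g
    by (intro pred_intros_logic pred_intros_finite I
        pred_A pred_hit measurable_component_hit hit_algebra_ident measurable_act_all)
  then have "Measurable.pred ?H (\<lambda>\<omega>. \<omega> \<in> A \<and>
      (\<forall>g\<in>\<Gamma> - F. \<not> ((\<forall>i\<in>I. g \<in> \<omega> i) \<and> act_all I g \<omega> \<in> A)))"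
    by (intro pred_intros_logic(3) measurable_pred_countable(1)[OF countable_\<Gamma>] pred_A measurable_ident_sets refl)
  then have B: "B \<in> sets ?H"
    unfolding B_def by (simp add: pred_def)
  define B0 where "B0 = {\<omega> \<in> space ?N. \<omega> \<in> B}"
  \<comment> \<open>\<open>E x\<close> stands for the translate of \<open>B0\<close> by
    \<open>x\<close>: its preimage under \<open>act_all I x\<close> is \<open>B0\<close>. The clause
    on \<open>- x\<close> places it where the density is 1.\<close>
  define E where "E x = {\<omega> \<in> space ?L. (\<forall>i\<in>I. - x \<in> \<omega> i) \<and> act_all I (- x) \<omega> \<in> B}" for x
  have E_sets: "E x \<in> sets ?L" for x
  proof -
    have "Measurable.pred ?L (\<lambda>\<omega>. (\<forall>i\<in>I. - x \<in> \<omega> i) \<and> act_all I (- x) \<omega> \<in> B)"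
      by (intro pred_intros_logic pred_intros_finite I pred_hit measurable_component_hit
          pred_sets2[OF B] measurable_act_all lift_ident)
    then show ?thesis
      unfolding E_def by (simp add: pred_def)
  qed
  have sets_L: "sets ?L = sets ?H"
    by (rule sets_PiM_cong) simp_all
  have translate: "emeasure ?N B0 = emeasure ?L (E x)" if "x \<in> \<Lambda>" for x
  proof -
    have "- x \<in> act x (\<omega> i)" if "\<omega> \<in> space ?N" "i \<in> I" for \<omega> i
      using that transversal_zero by (auto simp: space_PiM space_\<nu> in_act_iff)
    moreover have "act_all I (- x) (act_all I x \<omega>) = \<omega>" if "\<omega> \<in> space ?N" for \<omega>
      using that by (simp add: act_all_act_all act_all_0 space_PiM PiE_iff)
    moreover have "act_all I x \<omega> \<in> space ?L" if "\<omega> \<in> space ?N" for \<omega>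
      by (simp add: space_PiM act_all_def)
    ultimately have "B0 = act_all I x -` E x \<inter> space ?N"
      unfolding B0_def E_def by (auto simp: act_all_apply)
    then have "emeasure ?N B0 = emeasure (distr ?N ?H (act_all I x)) (E x)"
      using E_sets sets_L by (simp add: emeasure_distr measurable_act_all measurable_\<nu>_hit)
    also have "\<dots> = emeasure ?L ({\<omega> \<in> space ?L. \<forall>i\<in>I. - x \<in> \<omega> i} \<inter> E x)"
      unfolding distr_act_all_eq_density[OF I that]
      by (intro emeasure_restricted E_sets sets_all_hit I lift_ident)
    also have "{\<omega> \<in> space ?L. \<forall>i\<in>I. - x \<in> \<omega> i} \<inter> E x = E x"
      unfolding E_def by auto
    finally show ?thesis .
  qed
  \<comment> \<open>The element \<open>- x + y\<close> carries the point
    \<open>act_all I (- y) \<omega>\<close> of \<open>B\<close> to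
    \<open>act_all I (- x) \<omega>\<close>, which is in \<open>A\<close>; by the choice of
    \<open>B\<close> it must belong to \<open>F\<close>.\<close>
  have return: "- x + y \<in> F" if "x \<in> \<Lambda>" "y \<in> \<Lambda>" "\<omega> \<in> E x" "\<omega> \<in> E y" for x y \<omega>
  proof (rule ccontr)
    define \<eta> where "\<eta> = act_all I (- y) \<omega>"
    assume "- x + y \<notin> F"
    then have "- x + y \<in> \<Gamma> - F"
      using that unfolding \<Gamma>_def by force
    moreover have "\<eta> \<in> B"
      using that(4) unfolding E_def \<eta>_def by simp
    ultimately have "\<not> ((\<forall>i\<in>I. - x + y \<in> \<eta> i) \<and> act_all I (- x + y) \<eta> \<in> A)"
      unfolding B_def by simp
    moreover have "act_all I (- x + y) \<eta> = act_all I (- x) \<omega>"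
      unfolding \<eta>_def by (simp add: act_all_act_all add.assoc)
    then have mem: "act_all I (- x + y) \<eta> \<in> A"
      using that(3) unfolding E_def B_def by simp
    \<comment> \<open>The image lies in \<open>A\<close>, so its coordinates contain 0, which means
      that the translating element lies in \<open>\<eta> i\<close>.\<close>
    moreover have "- x + y \<in> \<eta> i" if "i \<in> I" for i
      using zero[OF mem that] that by (simp add: act_all_apply in_act_iff)
    ultimately show False by simp
  qed
  have overlap: "(\<Sum>x\<in>J. indicator (E x) \<omega>) \<le> (of_nat (card F) :: ennreal)"
    if J: "finite J" "J \<subseteq> \<Lambda>" for J \<omega>
  proof -
    have "card {x \<in> J. \<omega> \<in> E x} \<le> card F"
    proof (cases "{x \<in> J. \<omega> \<in> E x} = {}")
      case True
      then show ?thesis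
        by (simp only: card.empty)
    next
      case False
      then obtain y where y: "y \<in> J" "\<omega> \<in> E y" by auto
      have "{x \<in> J. \<omega> \<in> E x} \<subseteq> (\<lambda>g. y - g) ` F"
      proof
        fix x assume x: "x \<in> {x \<in> J. \<omega> \<in> E x}"
        then have "- x + y \<in> F"
          using return[of x y \<omega>] y J(2) by auto
        moreover have "x = y - (- x + y)"
          by (simp add: diff_conv_add_uminus minus_add add.assoc[symmetric] del: add_uminus_conv_diff)
        ultimately show "x \<in> (\<lambda>g. y - g) ` F"
          by (rule rev_image_eqI)
      qed
      then have "card {x \<in> J. \<omega> \<in> E x} \<le> card ((\<lambda>g. y - g) ` F)"
        using F by (intro card_mono) auto
      also have "\<dots> \<le> card F"
        using F by (rule card_image_le)
      finally show ?thesis .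
    qed
    moreover have "(\<Sum>x\<in>J. indicator (E x) \<omega>) = (of_nat (card {x \<in> J. \<omega> \<in> E x}) :: ennreal)"
      using J(1) by (simp add: indicator_def sum.If_cases Int_def)
    ultimately show ?thesis
      by simp
  qed
  interpret lift: finite_measure lift by (rule finite_lift)
  interpret L: product_sigma_finite "\<lambda>_. lift" by unfold_locales
  define c where "c = of_nat (card F) * emeasure ?L (space ?L)"
  have "emeasure ?L (space ?L) = (\<Prod>i\<in>I. emeasure lift (space lift))"
    unfolding space_PiM using I by (intro L.emeasure_PiM) (auto simp del: sets_lift space_lift)
  then have c: "c \<noteq> \<infinity>"
    using I lift.emeasure_finite by (simp add: c_def ennreal_mult_eq_top_iff ennreal_prod_eq_top del: prod_constant)
  \<comment> \<open>Any \<open>n\<close> elements of the infinite set \<open>\<Lambda>\<close> give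
    \<open>n\<close> sets \<open>E x\<close> with the measure of \<open>B0\<close>; integrating the
    overlap bound gives a constant independent of \<open>n\<close>.\<close>
  have bound: "of_nat n * emeasure ?N B0 \<le> c" for n
  proof -
    obtain J where J: "J \<subseteq> \<Lambda>" "finite J" "card J = n"
      using infinite_arbitrarily_large[OF infinite_\<Lambda>] by metis
    have "of_nat n * emeasure ?N B0 = (\<Sum>x\<in>J. emeasure ?N B0)"
      using J by simp
    also have "\<dots> = (\<Sum>x\<in>J. emeasure ?L (E x))"
      using translate J(1) by (intro sum.cong refl) auto
    also have "\<dots> = (\<integral>\<^sup>+ \<omega>. (\<Sum>x\<in>J. indicator (E x) \<omega>) \<partial>?L)"
      using E_sets by (subst nn_integral_sum) auto
    also have "\<dots> \<le> (\<integral>\<^sup>+ \<omega>. of_nat (card F) \<partial>?L)"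
      using overlap J by (intro nn_integral_mono) auto
    finally show ?thesis
      by (simp add: c_def)
  qed
  have "emeasure ?N B0 = 0"
  proof (rule ccontr)
    assume nz: "emeasure ?N B0 \<noteq> 0"
    have fin: "emeasure ?N B0 \<noteq> \<infinity>"
      using bound[of 1] c by (auto simp: top_unique)
    have "c / emeasure ?N B0 \<noteq> \<infinity>"
      using nz c by (simp add: ennreal_divide_eq_top_iff)
    then obtain n where n: "c / emeasure ?N B0 < of_nat n"
      using ennreal_Ex_less_of_nat by (auto simp: less_top)
    have "of_nat n * emeasure ?N B0 / emeasure ?N B0 \<le> c / emeasure ?N B0"
      by (rule divide_right_mono_ennreal) (rule bound)
    then have "of_nat n \<le> c / emeasure ?N B0"
      using nz fin mult_divide_eq_ennreal[of "emeasure ?N B0" "of_nat n"] by simp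
    with n show False by simp
  qed
  moreover have "B0 \<in> sets ?N"
  proof -
    \<comment> \<open>\<open>act_all I 0\<close> is the identity on this space and serves as the
      measurable inclusion into the product of hit algebras.\<close>
    have "act_all I 0 -` B \<inter> space ?N \<in> sets ?N"
      using measurable_act_all[OF measurable_\<nu>_hit] B by (rule measurable_sets)
    moreover have "act_all I 0 \<omega> = \<omega>" if "\<omega> \<in> space ?N" for \<omega>
      using that by (intro act_all_0) (simp add: space_PiM PiE_iff)
    then have "act_all I 0 -` B \<inter> space ?N = B0"
      unfolding B0_def by auto
    ultimately show ?thesis by simp
  qed
  ultimately have "B0 \<in> null_sets ?N"
    by (rule null_setsI)
  moreover have "{\<omega> \<in> space ?N. \<not> (\<omega> \<in> A \<longrightarrow>
      (\<exists>g. g \<notin> F \<and> (\<forall>i\<in>I. g \<in> \<omega> i) \<and> act_all I g \<omega> \<in> A))} \<subseteq> B0"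
  proof
    fix \<omega> assume "\<omega> \<in> {\<omega> \<in> space ?N. \<not> (\<omega> \<in> A \<longrightarrow>
      (\<exists>g. g \<notin> F \<and> (\<forall>i\<in>I. g \<in> \<omega> i) \<and> act_all I g \<omega> \<in> A))}"
    then show "\<omega> \<in> B0"
      using sets.sets_into_space[OF A] unfolding B0_def B_def by auto
  qed
  ultimately show ?thesis
    by (rule AE_I')
qed

section \<open>From returns to cylinders to Chabauty-Fell convergence\<close>

text \<open>For subsets of \<open>\<Lambda>\<close>, missing a compact \<open>K\<close> depends on
  the finitely many points of \<open>\<Lambda> \<inter> K\<close>, and meeting an open
  \<open>V\<close> is witnessed by one point of \<open>Q\<close>; so subbasic conditions are
  eventually satisfied.\<close>

lemma limitin_chabauty_fell:
  assumes Q: "closed Q" "Q \<subseteq> \<Lambda>" and f: "\<And>n. closed (f n)" "\<And>n. f n \<subseteq> \<Lambda>"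
    and conv: "\<And>x. x \<in> \<Lambda> \<Longrightarrow> \<forall>\<^sub>F n in F. x \<in> f n \<longleftrightarrow> x \<in> Q"
  shows "limitin chabauty_fell f Q F"
proof -
  have "\<forall>\<^sub>F n in F. f n \<in> U"
    if "generate_topology_on ({{P :: 'a set. closed P \<and> P \<inter> K = {}} | K. compact K} \<union>
      {{P. closed P \<and> P \<inter> V \<noteq> {}} | V. open V}) U" "Q \<in> U" for U
    using that
  proof (induction rule: generate_topology_on.induct)
    case (Int a b)
    then show ?case by (simp add: eventually_conj)
  next
    case (UN C)
    then obtain k where k: "k \<in> C" "Q \<in> k" by auto
    then have "\<forall>\<^sub>F n in F. f n \<in> k"
      using UN.IH by simp
    then show ?case
      by eventually_elim (use k in auto)
  next
    case (Basis s)
    then consider K where "compact K" "s = {P. closed P \<and> P \<inter> K = {}}"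
      | V where "open V" "s = {P. closed P \<and> P \<inter> V \<noteq> {}}"
      by auto
    then show ?case
    proof cases
      case 1
      have "finite (\<Lambda> \<inter> K)"
        by (rule uniformly_discrete_finite_compact[OF uniformly_discrete_\<Lambda> 1(1)])
      then have "\<forall>\<^sub>F n in F. \<forall>x\<in>\<Lambda> \<inter> K. x \<in> f n \<longleftrightarrow> x \<in> Q"
        by (rule eventually_ball_finite) (use conv in auto)
      then show ?thesis
      proof eventually_elim
        case (elim n)
        have "Q \<inter> K = {}" using Basis(2) 1(2) by simp
        with elim f(2)[of n] have "f n \<inter> K = {}" by auto
        then show ?case using 1(2) f(1) by simp
      qed
    next
      case 2
      then obtain x where x: "x \<in> Q" "x \<in> V" using Basis(2) by auto
      have "\<forall>\<^sub>F n in F. x \<in> f n \<longleftrightarrow> x \<in> Q"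
        by (rule conv) (use x(1) Q(2) in auto)
      then show ?thesis
        by eventually_elim (use x 2(2) f(1) in auto)
    qed
  qed simp
  then show ?thesis
    unfolding limitin_def topspace_chabauty_fell
    using Q(1) by (simp add: chabauty_fell_def openin_topology_generated_by_iff)
qed

text \<open>The clause \<open>0 \<in> \<omega> i\<close> is there for the hypothesis
  \<open>zero\<close> of \<open>AE_return\<close>.\<close>

definition cylinder :: "'i set \<Rightarrow> nat \<Rightarrow> ('i \<Rightarrow> 'a set) \<Rightarrow> ('i \<Rightarrow> 'a set) set" where
  "cylinder I n S = {\<omega> \<in> space (\<Pi>\<^sub>M i\<in>I. hit_algebra).
     \<forall>i\<in>I. 0 \<in> \<omega> i \<and> (\<forall>k<n. enum k \<in> \<omega> i \<longleftrightarrow> enum k \<in> S i)}"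

lemma sets_cylinder:
  assumes "finite I"
  shows "cylinder I n S \<in> sets (\<Pi>\<^sub>M i\<in>I. hit_algebra)"
proof -
  let ?H = "\<Pi>\<^sub>M i\<in>I. hit_algebra :: 'a set measure"
  have "Measurable.pred ?H (\<lambda>\<omega>. 0 \<in> \<omega> i \<and> (\<forall>k\<in>{..<n}. enum k \<in> \<omega> i \<longleftrightarrow> enum k \<in> S i))"
    if i: "i \<in> I" for i
    by (intro pred_intros_logic pred_intros_finite pred_hit measurable_component_hit
        hit_algebra_ident i finite_lessThan measurable_const) simp
  then have "Measurable.pred ?H
      (\<lambda>\<omega>. \<forall>i\<in>I. 0 \<in> \<omega> i \<and> (\<forall>k\<in>{..<n}. enum k \<in> \<omega> i \<longleftrightarrow> enum k \<in> S i))"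
    by (intro pred_intros_finite(3) assms)
  then show ?thesis
    unfolding cylinder_def by (simp add: pred_def Ball_def)
qed

lemma AE_recurrence:
  assumes I: "finite I" "I \<noteq> {}"
  shows "AE \<omega> in (\<Pi>\<^sub>M i\<in>I. \<nu>). \<exists>g :: nat \<Rightarrow> 'a.
    (\<forall>n. g n \<in> (\<Inter>i\<in>I. \<omega> i)) \<and>
    (\<forall>i\<in>I. limitin chabauty_fell (\<lambda>n. act (g n) (\<omega> i)) (\<omega> i) sequentially) \<and>
    tends_to_infinity g"
proof -
  let ?N = "\<Pi>\<^sub>M i\<in>I. \<nu>"
  \<comment> \<open>Each \<open>n\<close> has finitely many patterns, so \<open>AE_return\<close> is
    applied countably often, with the first \<open>n\<close> elements of \<open>\<Lambda>\<close> as
    the forbidden set \<open>F\<close>.\<close>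
  define patterns where "patterns n = (\<Pi>\<^sub>E i\<in>I. Pow (enum ` {..<n}))" for n :: nat
  have "countable (patterns n)" for n
    unfolding patterns_def using I by (intro countable_finite finite_PiE) auto
  moreover have "AE \<omega> in ?N. \<omega> \<in> cylinder I n S \<longrightarrow>
      (\<exists>g. g \<notin> enum ` {..<n} \<and> (\<forall>i\<in>I. g \<in> \<omega> i) \<and> act_all I g \<omega> \<in> cylinder I n S)" for n S
    using I by (intro AE_return sets_cylinder) (auto simp: cylinder_def)
  ultimately have "AE \<omega> in ?N. \<forall>n. \<forall>S\<in>patterns n. \<omega> \<in> cylinder I n S \<longrightarrow>
      (\<exists>g. g \<notin> enum ` {..<n} \<and> (\<forall>i\<in>I. g \<in> \<omega> i) \<and> act_all I g \<omega> \<in> cylinder I n S)"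
    unfolding AE_all_countable by (intro allI AE_ball_countable')
  with AE_space show ?thesis
  proof eventually_elim
    case (elim \<omega>)
    have T: "\<omega> i \<in> transversal P" if "i \<in> I" for i
      using elim(1) that by (auto simp: space_PiM space_\<nu>)
    \<comment> \<open>The pattern of \<open>\<omega>\<close> itself, so that a return to its
      cylinder agrees with \<open>\<omega>\<close> on all \<open>enum k\<close> with
      \<open>k < n\<close>.\<close>
    define S where "S n = (\<lambda>i\<in>I. \<omega> i \<inter> enum ` {..<n})" for n
    have "S n \<in> patterns n" for n
      unfolding S_def patterns_def by auto
    moreover have "\<omega> \<in> cylinder I n (S n)" for n
      using elim(1) T transversal_zero by (auto simp: cylinder_def S_def space_PiM PiE_iff)
    ultimately have "\<forall>n. \<exists>g. g \<notin> enum ` {..<n} \<and> (\<forall>i\<in>I. g \<in> \<omega> i) \<and>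
        act_all I g \<omega> \<in> cylinder I n (S n)"
      using elim(2) by simp
    from choice[OF this] obtain g where g: "\<And>n. g n \<notin> enum ` {..<n}"
        "\<And>n i. i \<in> I \<Longrightarrow> g n \<in> \<omega> i" "\<And>n. act_all I (g n) \<omega> \<in> cylinder I n (S n)"
      by auto
    have "limitin chabauty_fell (\<lambda>n. act (g n) (\<omega> i)) (\<omega> i) sequentially" if i: "i \<in> I" for i
    proof (rule limitin_chabauty_fell)
      show "closed (\<omega> i)" "\<And>n. closed (act (g n) (\<omega> i))"
        using transversal_closed[OF T[OF i]] by (simp_all add: closed_act)
      show "\<omega> i \<subseteq> \<Lambda>"
        using transversal_subset[OF T[OF i]] by auto
      show "act (g n) (\<omega> i) \<subseteq> \<Lambda>" for n
      proof
        fix x assume "x \<in> act (g n) (\<omega> i)"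
        then have "x + g n - g n \<in> \<Lambda>"
          using g(2)[OF i] by (intro transversal_difference[OF T[OF i]]) (simp_all add: in_act_iff)
        then show "x \<in> \<Lambda>" by simp
      qed
      fix x assume "x \<in> \<Lambda>"
      then obtain k where k: "x = enum k"
        by (rule enum_surj)
      show "\<forall>\<^sub>F n in sequentially. x \<in> act (g n) (\<omega> i) \<longleftrightarrow> x \<in> \<omega> i"
        using eventually_gt_at_top[of k]
      proof eventually_elim
        case (elim n)
        have "enum k \<in> act_all I (g n) \<omega> i \<longleftrightarrow> enum k \<in> S n i"
          using g(3)[of n] i elim unfolding cylinder_def by simp
        then show ?case
          using i elim unfolding k S_def by (simp add: act_all_apply)
      qed
    qed
    \<comment> \<open>A compact set contains finitely many elements \<open>enum k\<close> of
      \<open>\<Lambda>\<close>, and \<open>g n\<close> avoids each of them once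
      \<open>n > k\<close>.\<close>
    moreover have "tends_to_infinity g"
      unfolding tends_to_infinity_def
    proof (intro allI impI)
      fix K :: "'a set" assume "compact K"
      then have "finite (\<Lambda> \<inter> K)"
        by (rule uniformly_discrete_finite_compact[OF uniformly_discrete_\<Lambda>])
      moreover have "\<forall>\<^sub>F n in sequentially. g n \<noteq> x" if "x \<in> \<Lambda> \<inter> K" for x
      proof -
        obtain k where k: "x = enum k"
          using \<open>x \<in> \<Lambda> \<inter> K\<close> enum_surj[of x] by auto
        show ?thesis
          using eventually_gt_at_top[of k]
        proof eventually_elim
          case (elim n)
          then show ?case using g(1)[of n] k by auto
        qed
      qed
      ultimately have "\<forall>\<^sub>F n in sequentially. \<forall>x\<in>\<Lambda> \<inter> K. g n \<noteq> x"
        by (intro eventually_ball_finite) auto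
      \<comment> \<open>Some index in \<open>I\<close> is required here, to place \<open>g n\<close>
        in a point of the transversal and thereby in \<open>\<Lambda>\<close>.\<close>
      moreover have "g n \<in> \<Lambda>" for n
        using I(2) g(2) transversal_subset[OF T] by auto
      ultimately show "\<forall>\<^sub>F n in sequentially. g n \<notin> K"
        by (auto elim!: eventually_mono)
    qed
    ultimately show ?case
      using g(2) by (intro exI[of _ g]) simp
  qed
qed

end

theorem theorem1p1:
  fixes P :: "'a::{topological_group_add, t2_space, second_countable_topology} set"
    and \<Lambda> :: "'a set"
    and m :: "'a measure"
    and \<mu> \<nu> :: "'a set measure"
    and r :: nat
  assumes "locally_compact_space (euclidean :: 'a topology)"
    and "\<not> compact (UNIV :: 'a set)"
    and "unimodular TYPE('a)"
    and "haar_measure m"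
    and "\<Lambda> = difference_set P P"
    and "relatively_dense \<Lambda>"
    and "uniformly_discrete (\<Lambda> + \<Lambda> + \<Lambda>)"
    and "invariant_probability P \<mu>"
    and "transverse_measure m P \<mu> \<nu>"
    and "r \<ge> 1"
  shows "AE Q in (\<Pi>\<^sub>M i\<in>{1..r}. \<nu>).
           \<exists>g :: nat \<Rightarrow> 'a.
             (\<forall>n. g n \<in> (\<Inter>i\<in>{1..r}. Q i)) \<and>
             (\<forall>i\<in>{1..r}. limitin chabauty_fell (\<lambda>n. act (g n) (Q i)) (Q i) sequentially) \<and>
             tends_to_infinity g"
proof -
  have "transverse_system P \<Lambda> m \<mu> \<nu>"
    using assms by (intro transverse_system.intro)
  then show ?thesis
    using \<open>r \<ge> 1\<close> by (intro transverse_system.AE_recurrence[of P \<Lambda> m \<mu> \<nu>]) simp_all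
qed

end
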